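(* Let $I$ be a homogeneous Artinian ideal of $R=k[x_1,x_2,x_3]$. If $A=R/I$ has the strong Stanley property, then the minimal system of generators of $\mathrm{gin}(I)$ is determined by the Hilbert function of $I$. In particular, if $J$ is a homogeneous ideal of $R$ with $H(R/I,d)=H(R/J,d)$ for all $d$, and if $R/J$ has the strong Stanley property, then $\mathrm{gin}(I)=\mathrm{gin}(J)$.
   Context: $k$ is a field of characteristic $0$, $R=k[x_1,x_2,x_3]$ with the standard grading. A homogeneous ideal $I\subsetneq R$ is called Artinian if $R/I$ is Artinian. $\mathrm{gin}(I)$ denotes the generic initial ideal of $I$ with respect to the reverse lexicographic order (with $x_1>x_2>x_3$): $\mathrm{gin}(I)=\mathrm{in}(gI)$ for $g$ in a nonempty Zariski open subset of $GL_3(k)$. The minimal system of generators of a monomial ideal means its minimal monomial generators. $H(R/I,d)=\dim_k(R/I)_d$. Strong Stanley property of an Artinian $A=R/I=\bigoplus_{i=0}^t A_i$ with $t=\max\{i \mid A_i\ne 0\}$: there is a linear form $L\in R$ such that $\times L^{t-2i}:A_i\to A_{t-i}$ is bijective for each $i=0,1,\ldots,[t/2]$, where $[\cdot]$ is the integer part. *)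

theory Defs
  imports "HOL-Analysis.Analysis" "HOL-Library.Poly_Mapping"
begin

(* Polynomials are finitely supported maps from exponent vectors to coefficients, with the
   convolution product of Poly_Mapping.  The variables x_1, x_2, x_3 are indexed by the
   type 3, whose literals are read modulo 3, so that (3 :: 3) = 0; the order on that type
   is never used. *)

type_synonym monom3 = "3 \<Rightarrow>\<^sub>0 nat"
type_synonym 'k poly3 = "monom3 \<Rightarrow>\<^sub>0 'k"

definition const :: "'k \<Rightarrow> ('v \<Rightarrow>\<^sub>0 nat) \<Rightarrow>\<^sub>0 'k::zero"
  where "const c = Poly_Mapping.single 0 c"

definition var :: "'v \<Rightarrow> ('v \<Rightarrow>\<^sub>0 nat) \<Rightarrow>\<^sub>0 'k::zero_neq_one"
  where "var i = Poly_Mapping.single (Poly_Mapping.single i 1) 1"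

definition monomial :: "('v \<Rightarrow>\<^sub>0 nat) \<Rightarrow> ('v \<Rightarrow>\<^sub>0 nat) \<Rightarrow>\<^sub>0 'k::zero_neq_one"
  where "monomial m = Poly_Mapping.single m 1"

(* Evaluation in a commutative ring 'r at the point \<sigma>; \<phi> embeds the coefficients. *)
definition eval_poly ::
  "('k \<Rightarrow> 'r) \<Rightarrow> ('v \<Rightarrow> 'r) \<Rightarrow> (('v \<Rightarrow>\<^sub>0 nat) \<Rightarrow>\<^sub>0 'k::zero) \<Rightarrow> 'r::comm_ring_1"
  where "eval_poly \<phi> \<sigma> f =
    (\<Sum>m\<in>Poly_Mapping.keys f. \<phi> (Poly_Mapping.lookup f m) *
       (\<Prod>v\<in>Poly_Mapping.keys m. \<sigma> v ^ Poly_Mapping.lookup m v))"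

definition mdeg :: "monom3 \<Rightarrow> nat"
  where "mdeg m = (\<Sum>i\<in>UNIV. Poly_Mapping.lookup m i)"

definition forms :: "nat \<Rightarrow> 'k::zero poly3 set"
  where "forms d = {f. \<forall>m\<in>Poly_Mapping.keys f. mdeg m = d}"

(* Ideals are the submodules of the ring regarded as a module over itself. *)
abbreviation is_ideal :: "'a::comm_ring_1 set \<Rightarrow> bool"
  where "is_ideal \<equiv> module.subspace (*)"

abbreviation ideal_gen :: "'a::comm_ring_1 set \<Rightarrow> 'a set"
  where "ideal_gen \<equiv> module.span (*)"

definition homogeneous_ideal :: "'k::comm_ring_1 poly3 set \<Rightarrow> bool"
  where "homogeneous_ideal I \<longleftrightarrow> (\<exists>G. G \<subseteq> (\<Union>d. forms d) \<and> I = ideal_gen G)"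

(* The ideals of R/I are the J/I with J an ideal of R containing I, so the descending chain
   condition for R/I is stated for chains of such J. *)
definition artinian_ideal :: "'a::comm_ring_1 set \<Rightarrow> bool"
  where "artinian_ideal I \<longleftrightarrow> is_ideal I \<and> I \<noteq> UNIV \<and>
    (\<forall>J :: nat \<Rightarrow> 'a set.
       (\<forall>n. is_ideal (J n) \<and> I \<subseteq> J n \<and> J (Suc n) \<subseteq> J n) \<longrightarrow>
       (\<exists>N. \<forall>n\<ge>N. J n = J N))"

definition cong_mod :: "'a::comm_ring_1 set \<Rightarrow> ('a \<times> 'a) set"
  where "cong_mod I = {(f, g). f - g \<in> I}"

(* (R/I)_d, as the set of the residue classes f + I with f in R_d *)
definition quot_part :: "'k::comm_ring_1 poly3 set \<Rightarrow> nat \<Rightarrow> 'k poly3 set set"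
  where "quot_part I d = (\<lambda>f. cong_mod I `` {f}) ` forms d"

(* Multiplication by p on residue classes: f + I goes to pf + I. *)
definition quot_mult :: "'a::comm_ring_1 set \<Rightarrow> 'a \<Rightarrow> 'a set \<Rightarrow> 'a set"
  where "quot_mult I p C = cong_mod I `` ((*) p ` C)"

(* H(R/I,d) = n iff there are b_0, ..., b_(n-1) in R_d whose classes form a k-basis of
   (R/I)_d, i.e. such that the map sending (c_i) to the class of \<Sum> c_i b_i is a bijection
   from k^n onto (R/I)_d. *)
definition hilbert_fun :: "'k::field poly3 set \<Rightarrow> nat \<Rightarrow> nat"
  where "hilbert_fun I d = (THE n. \<exists>b :: nat \<Rightarrow> 'k poly3. (\<forall>i<n. b i \<in> forms d) \<and>
    bij_betw (\<lambda>c. cong_mod I `` {\<Sum>i<n. const (c i) * b i})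
      ({..<n} \<rightarrow>\<^sub>E UNIV) (quot_part I d))"

(* The largest degree in which R/I is nonzero; meaningful when R/I is nonzero and Artinian. *)
definition top_degree :: "'k::comm_ring_1 poly3 set \<Rightarrow> nat"
  where "top_degree I = Max {i. quot_part I i \<noteq> {cong_mod I `` {0}}}"

definition strong_stanley :: "'k::comm_ring_1 poly3 set \<Rightarrow> bool"
  where "strong_stanley I \<longleftrightarrow> (let t = top_degree I in
    \<exists>L\<in>forms 1. \<forall>i\<le>t div 2.
      bij_betw (quot_mult I (L ^ (t - 2 * i))) (quot_part I i) (quot_part I (t - i)))"

(* The graded reverse lexicographic order with x_1 > x_2 > x_3.  In equal degrees, two
   monomials agreeing in x_2 and x_3 are equal. *)
definition revlex_less :: "monom3 \<Rightarrow> monom3 \<Rightarrow> bool"  (infix "\<prec>" 50)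
  where "m \<prec> n \<longleftrightarrow> mdeg m < mdeg n \<or>
    mdeg m = mdeg n \<and>
      (Poly_Mapping.lookup m 3 > Poly_Mapping.lookup n 3 \<or>
       Poly_Mapping.lookup m 3 = Poly_Mapping.lookup n 3 \<and>
       Poly_Mapping.lookup m 2 > Poly_Mapping.lookup n 2)"

definition is_leading_monom :: "'k::zero poly3 \<Rightarrow> monom3 \<Rightarrow> bool"
  where "is_leading_monom f m \<longleftrightarrow>
    m \<in> Poly_Mapping.keys f \<and> (\<forall>n\<in>Poly_Mapping.keys f. n = m \<or> n \<prec> m)"

definition initial_ideal :: "'k::comm_ring_1 poly3 set \<Rightarrow> 'k poly3 set"
  where "initial_ideal I = ideal_gen {monomial m | m. \<exists>f\<in>I. is_leading_monom f m}"

(* g acts by the k-algebra map with x_j \<mapsto> \<Sum>_i g_ij x_i. *)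
definition lin_subst :: "'k::comm_ring_1 ^ 3 ^ 3 \<Rightarrow> 'k poly3 \<Rightarrow> 'k poly3"
  where "lin_subst g = eval_poly const (\<lambda>j. \<Sum>i\<in>UNIV. const (g $ i $ j) * var i)"

(* The regular functions on GL_3 are the p / det^r with p a polynomial in the nine matrix
   entries, so polynomials suffice to describe the Zariski topology of GL_3. *)
definition zariski_open_GL3 :: "('k::field ^ 3 ^ 3) set \<Rightarrow> bool"
  where "zariski_open_GL3 U \<longleftrightarrow> (\<exists>S :: ((3 \<times> 3 \<Rightarrow>\<^sub>0 nat) \<Rightarrow>\<^sub>0 'k) set.
    U = {g. invertible g \<and> (\<exists>p\<in>S. eval_poly (\<lambda>c. c) (\<lambda>(i, j). g $ i $ j) p \<noteq> 0)})"

(* By Galligo's theorem exactly one ideal M qualifies when I is homogeneous and k infinite. *)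
definition gin :: "'k::field poly3 set \<Rightarrow> 'k poly3 set"
  where "gin I = (THE M. \<exists>U. zariski_open_GL3 U \<and> U \<noteq> {} \<and>
    (\<forall>g\<in>U. initial_ideal (lin_subst g ` I) = M))"

definition min_monomial_gens :: "'k::comm_ring_1 poly3 set \<Rightarrow> 'k poly3 set"
  where "min_monomial_gens M = (THE G. G \<subseteq> range monomial \<and> ideal_gen G = M \<and>
    (\<forall>G'. G' \<subset> G \<longrightarrow> ideal_gen G' \<noteq> M))"

end

theory Submission
  imports Defs
begin

text \<open>
  Let \<open>h = g\<inverse>\<close>, let \<open>\<ell>\<^sub>1, \<ell>\<^sub>2, \<ell>\<^sub>3\<close> be the linear forms whose coefficients are the columns of \<open>h\<close>,
  and write \<open>\<ell>\<^sup>n\<close> for the value of the monomial \<open>x\<^sup>n\<close> at these forms.  Applying the inverse of \<open>g\<close> shows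
  that \<open>x\<^sup>m\<close> is a leading monomial of \<open>gI\<close> iff \<open>\<ell>\<^sup>m\<close> is, modulo \<open>I\<close>, a linear combination of the
  \<open>\<ell>\<^sup>n\<close> with \<open>n \<prec> m\<close> of the same degree (\<open>leading_monom_iff\<close>).  So the moving ideal \<open>gI\<close> is replaced by
  moving vectors in the fixed spaces \<open>(R/I)\<^sub>d\<close>, and its initial ideal is read off from the ranks of the
  families of all \<open>\<ell>\<^sup>n\<close> with \<open>n\<close> in an initial segment of the order.  Such a rank can only drop on a
  proper closed set, so for \<open>g\<close> in a nonempty open set all these ranks are the largest possible
  (\<open>max_rank_generic\<close>).

  In the reverse lexicographic order the smallest monomials of degree \<open>d\<close> are those with a large
  exponent of \<open>x\<^sub>3\<close>.  The \<open>\<ell>\<^sup>n\<close> of degree \<open>d\<close> with \<open>n\<^sub>3 \<ge> c\<close> span \<open>\<ell>\<^sub>3\<^sup>c (R/I)\<close> in degree \<open>d\<close>, and its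
  dimension is the rank of multiplication by the \<open>c\<close>-th power of a general linear form on
  \<open>(R/I)\<close> in degree \<open>d - c\<close>.  The strong Stanley property makes this map injective or surjective, so the Hilbert
  function determines its rank (\<open>strong_stanley_rank\<close>, \<open>lefschetz_generic\<close>, \<open>dim_lower\<close>).  Hence the
  number of standard monomials of degree \<open>d\<close> with \<open>x\<^sub>3\<close>-exponent exactly \<open>c\<close> is known.

  Which ones they are follows from the fact that a generic initial ideal in characteristic \<open>0\<close> is
  stable under replacing a factor \<open>x\<^sub>2\<close> by \<open>x\<^sub>1\<close>.  In terms of the vectors \<open>\<ell>\<^sup>n\<close>: if \<open>\<ell>\<^sup>t\<close> depends on the
  smaller ones and the rank is maximal, then the vector with \<open>\<ell>\<^sub>2\<close> replaced once by \<open>\<ell>\<^sub>1\<close> depends on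
  smaller ones too, for otherwise the first-order change of \<open>\<ell>\<^sup>t\<close> under \<open>\<ell>\<^sub>2 \<mapsto> \<ell>\<^sub>2 + s\<ell>\<^sub>1\<close>
  would raise the rank (\<open>dependence_propagates\<close>).  The standard monomials \<open>x\<^sub>1\<^sup>a x\<^sub>2\<^sup>b x\<^sub>3\<^sup>c\<close> with given
  degree and given \<open>c\<close> are therefore those with \<open>a\<close> below their number.  This describes
  the initial ideal in terms of the Hilbert function alone (\<open>expected_gin\<close>), for all \<open>g\<close> in a nonempty
  open set; as two such sets meet, the ideal is the generic initial ideal (\<open>gin_eq_expected\<close>).
\<close>

section \<open>Polynomials as a vector space, and evaluation\<close>

lemma lookup_const_mult: "Poly_Mapping.lookup (const c * f) m = c * Poly_Mapping.lookup f m"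
  for c :: "'k::comm_ring_1"
  unfolding const_def mult_map_scale_conv_mult[symmetric]
  by (simp add: Poly_Mapping.map.rep_eq when_def)

definition scal :: "'k::comm_ring_1 \<Rightarrow> (('v \<Rightarrow>\<^sub>0 nat) \<Rightarrow>\<^sub>0 'k) \<Rightarrow> (('v \<Rightarrow>\<^sub>0 nat) \<Rightarrow>\<^sub>0 'k)"
  where "scal c f = const c * f"

lemma lookup_scal [simp]: "Poly_Mapping.lookup (scal c f) m = c * Poly_Mapping.lookup f m"
  by (simp add: scal_def lookup_const_mult)

interpretation vs: vector_space "scal :: 'k::field \<Rightarrow> (('v \<Rightarrow>\<^sub>0 nat) \<Rightarrow>\<^sub>0 'k) \<Rightarrow> _"
  by standard (auto intro!: poly_mapping_eqI simp: lookup_add algebra_simps)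

interpretation vp: vector_space_pair "scal :: 'k::field \<Rightarrow> (('v \<Rightarrow>\<^sub>0 nat) \<Rightarrow>\<^sub>0 'k) \<Rightarrow> _"
  "scal :: 'k::field \<Rightarrow> (('v \<Rightarrow>\<^sub>0 nat) \<Rightarrow>\<^sub>0 'k) \<Rightarrow> _"
  by standard

text \<open>
  Ideals are the subspaces of this module; its associativity rule, reversed with respect to
  \<open>mult.assoc\<close>, would make the simplifier loop.
\<close>

interpretation idl: module "(*) :: 'a::comm_ring_1 \<Rightarrow> 'a \<Rightarrow> 'a"
  by standard (simp_all add: distrib_left distrib_right mult.assoc)

declare idl.scale_scale [simp del]

lemma scal_mult: "scal a f * g = scal a (f * g)" "f * scal a g = scal a (f * g)"
  for f :: "('v \<Rightarrow>\<^sub>0 nat) \<Rightarrow>\<^sub>0 'k::comm_ring_1"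
  by (simp_all add: scal_def algebra_simps)

lemma const_hom [simp]:
  "const 0 = 0" "const 1 = 1" "const (a + b) = const a + const b" "const (a * b) = const a * const b"
  for a b :: "'k::comm_ring_1"
  by (simp_all add: const_def single_add mult_single)

lemma poly_mapping_sum_singles:
  assumes "finite M" "Poly_Mapping.keys f \<subseteq> M"
  shows "f = (\<Sum>m\<in>M. Poly_Mapping.single m (Poly_Mapping.lookup f m))"
proof (rule poly_mapping_eqI)
  fix n
  have "(\<Sum>m\<in>M. Poly_Mapping.lookup (Poly_Mapping.single m (Poly_Mapping.lookup f m)) n)
      = (\<Sum>m\<in>M. if m = n then Poly_Mapping.lookup f n else 0)"
    by (intro sum.cong) (auto simp: lookup_single when_def)
  also have "\<dots> = Poly_Mapping.lookup f n"
    using assms by (auto simp: in_keys_iff)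
  finally show "Poly_Mapping.lookup f n =
      Poly_Mapping.lookup (\<Sum>m\<in>M. Poly_Mapping.single m (Poly_Mapping.lookup f m)) n"
    by (simp add: lookup_sum)
qed

lemma single_eq_scal: "Poly_Mapping.single m c = scal c (monomial m)" for c :: "'k::comm_ring_1"
  by (rule poly_mapping_eqI) (auto simp: monomial_def lookup_single when_def)

lemma poly_eq_sum_monomials:
  "finite M \<Longrightarrow> Poly_Mapping.keys f \<subseteq> M \<Longrightarrow>
    f = (\<Sum>m\<in>M. scal (Poly_Mapping.lookup f m) (monomial m))" for f :: "_ \<Rightarrow>\<^sub>0 'k::comm_ring_1"
  using poly_mapping_sum_singles[of M f] by (simp add: single_eq_scal)

definition eval_mon :: "('v \<Rightarrow> 'r) \<Rightarrow> ('v \<Rightarrow>\<^sub>0 nat) \<Rightarrow> 'r::comm_ring_1"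
  where "eval_mon \<sigma> m = (\<Prod>v\<in>Poly_Mapping.keys m. \<sigma> v ^ Poly_Mapping.lookup m v)"

lemma eval_mon_superset:
  "finite V \<Longrightarrow> Poly_Mapping.keys m \<subseteq> V \<Longrightarrow> eval_mon \<sigma> m = (\<Prod>v\<in>V. \<sigma> v ^ Poly_Mapping.lookup m v)"
  unfolding eval_mon_def by (intro prod.mono_neutral_left) (auto simp: in_keys_iff)

lemma eval_mon_add: "eval_mon \<sigma> (m + n) = eval_mon \<sigma> m * eval_mon \<sigma> n"
proof -
  define V where "V = Poly_Mapping.keys m \<union> Poly_Mapping.keys n"
  have "finite V" "Poly_Mapping.keys m \<subseteq> V" "Poly_Mapping.keys n \<subseteq> V" "Poly_Mapping.keys (m + n) \<subseteq> V"
    unfolding V_def by (auto simp: keys_add)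
  then show ?thesis
    by (simp add: eval_mon_superset lookup_add power_add prod.distrib)
qed

lemma eval_mon_zero [simp]: "eval_mon \<sigma> 0 = 1" and eval_mon_var [simp]: "eval_mon \<sigma> (Poly_Mapping.single v 1) = \<sigma> v"
  by (simp_all add: eval_mon_def)

lemma eval_poly_superset:
  assumes "finite M" "Poly_Mapping.keys f \<subseteq> M" "\<phi> 0 = 0"
  shows "eval_poly \<phi> \<sigma> f = (\<Sum>m\<in>M. \<phi> (Poly_Mapping.lookup f m) * eval_mon \<sigma> m)"
  unfolding eval_poly_def eval_mon_def[symmetric]
  using assms by (intro sum.mono_neutral_left) (auto simp: in_keys_iff)

locale coeff_hom =
  fixes \<phi> :: "'k::comm_ring_1 \<Rightarrow> 'r::comm_ring_1"
  assumes hom: "\<phi> 0 = 0" "\<phi> 1 = 1" "\<phi> (a + b) = \<phi> a + \<phi> b" "\<phi> (a * b) = \<phi> a * \<phi> b"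
begin

lemma eval_add: "eval_poly \<phi> \<sigma> (f + g) = eval_poly \<phi> \<sigma> f + eval_poly \<phi> \<sigma> g"
proof -
  define V where "V = Poly_Mapping.keys f \<union> Poly_Mapping.keys g"
  have "finite V" "Poly_Mapping.keys f \<subseteq> V" "Poly_Mapping.keys g \<subseteq> V" "Poly_Mapping.keys (f + g) \<subseteq> V"
    unfolding V_def by (auto simp: keys_add)
  then show ?thesis
    by (simp add: eval_poly_superset hom lookup_add sum.distrib algebra_simps)
qed

lemma eval_zero [simp]: "eval_poly \<phi> \<sigma> 0 = 0"
  by (simp add: eval_poly_def)

lemma eval_sum: "eval_poly \<phi> \<sigma> (\<Sum>i\<in>A. f i) = (\<Sum>i\<in>A. eval_poly \<phi> \<sigma> (f i))"
  by (induct A rule: infinite_finite_induct) (simp_all add: eval_add)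

lemma eval_single: "eval_poly \<phi> \<sigma> (Poly_Mapping.single m c) = \<phi> c * eval_mon \<sigma> m"
  using eval_poly_superset[of "{m}" "Poly_Mapping.single m c" \<phi> \<sigma>] hom(1) by (simp split: if_splits)

lemma eval_mult: "eval_poly \<phi> \<sigma> (f * g) = eval_poly \<phi> \<sigma> f * eval_poly \<phi> \<sigma> g"
proof -
  have f: "f = (\<Sum>m\<in>Poly_Mapping.keys f. Poly_Mapping.single m (Poly_Mapping.lookup f m))"
    and g: "g = (\<Sum>m\<in>Poly_Mapping.keys g. Poly_Mapping.single m (Poly_Mapping.lookup g m))"
    by (rule poly_mapping_sum_singles; simp)+
  have *: "eval_poly \<phi> \<sigma> (Poly_Mapping.single m a * Poly_Mapping.single n b) =
     eval_poly \<phi> \<sigma> (Poly_Mapping.single m a) * eval_poly \<phi> \<sigma> (Poly_Mapping.single n b)" for m a n b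
    by (simp add: mult_single eval_single hom eval_mon_add algebra_simps)
  show ?thesis
    by (subst (1 2) f, subst (1 2) g) (simp only: sum_product eval_sum *)
qed

lemma eval_const [simp]: "eval_poly \<phi> \<sigma> (const c) = \<phi> c"
  by (simp add: const_def eval_single)

lemma eval_var [simp]: "eval_poly \<phi> \<sigma> (var v) = \<sigma> v"
  by (simp add: var_def eval_single hom del: One_nat_def)

lemma eval_monomial: "eval_poly \<phi> \<sigma> (monomial m) = eval_mon \<sigma> m"
  by (simp add: monomial_def eval_single hom)

lemma eval_one [simp]: "eval_poly \<phi> \<sigma> 1 = 1"
  using eval_const[of \<sigma> 1] by (simp add: hom)

lemma eval_power: "eval_poly \<phi> \<sigma> (f ^ n) = eval_poly \<phi> \<sigma> f ^ n"
  by (induct n) (simp_all add: eval_mult)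

lemma eval_prod: "eval_poly \<phi> \<sigma> (\<Prod>i\<in>A. f i) = (\<Prod>i\<in>A. eval_poly \<phi> \<sigma> (f i))"
  by (induct A rule: infinite_finite_induct) (simp_all add: eval_mult)

end

interpretation cst: coeff_hom "const :: 'k::comm_ring_1 \<Rightarrow> (('v \<Rightarrow>\<^sub>0 nat) \<Rightarrow>\<^sub>0 'k)"
  by standard simp_all

interpretation idh: coeff_hom "\<lambda>c :: 'k::comm_ring_1. c"
  by standard simp_all

section \<open>Polynomial functions and generic properties\<close>

text \<open>
  The algebra of functions on \<open>'s\<close> generated by the coordinate functions \<open>X\<close>.  It is used for two parameter
  spaces: the line, and the space of \<open>3\<times>3\<close> matrices.
\<close>

inductive_set poly_funs :: "('s \<Rightarrow> 'k::comm_ring_1) set \<Rightarrow> ('s \<Rightarrow> 'k) set" for X where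
  const: "(\<lambda>s. c) \<in> poly_funs X"
| coord: "x \<in> X \<Longrightarrow> x \<in> poly_funs X"
| add: "F \<in> poly_funs X \<Longrightarrow> G \<in> poly_funs X \<Longrightarrow> (\<lambda>s. F s + G s) \<in> poly_funs X"
| mult: "F \<in> poly_funs X \<Longrightarrow> G \<in> poly_funs X \<Longrightarrow> (\<lambda>s. F s * G s) \<in> poly_funs X"

lemma poly_funs_uminus: "F \<in> poly_funs X \<Longrightarrow> (\<lambda>s. - F s) \<in> poly_funs X"
  using poly_funs.mult[OF poly_funs.const[of "-1"], of F X] by simp

lemma poly_funs_diff: "F \<in> poly_funs X \<Longrightarrow> G \<in> poly_funs X \<Longrightarrow> (\<lambda>s. F s - G s) \<in> poly_funs X"
  using poly_funs.add[OF _ poly_funs_uminus, of F X G] by simp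

lemma poly_funs_sum: "(\<And>i. i \<in> A \<Longrightarrow> F i \<in> poly_funs X) \<Longrightarrow> (\<lambda>s. \<Sum>i\<in>A. F i s) \<in> poly_funs X"
proof (induct A rule: infinite_finite_induct)
  case (insert a A)
  then have "(\<lambda>s. F a s + (\<Sum> i\<in>A. F i s)) \<in> poly_funs X"
    by (intro poly_funs.add) blast+
  then show ?case using insert.hyps by simp
qed (simp_all add: poly_funs.const)

lemma poly_funs_prod: "(\<And>i. i \<in> A \<Longrightarrow> F i \<in> poly_funs X) \<Longrightarrow> (\<lambda>s. \<Prod>i\<in>A. F i s) \<in> poly_funs X"
proof (induct A rule: infinite_finite_induct)
  case (insert a A)
  then have "(\<lambda>s. F a s * (\<Prod> i\<in>A. F i s)) \<in> poly_funs X"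
    by (intro poly_funs.mult) blast+
  then show ?case using insert.hyps by simp
qed (simp_all add: poly_funs.const)

lemma poly_funs_power: "F \<in> poly_funs X \<Longrightarrow> (\<lambda>s. F s ^ n) \<in> poly_funs X"
  by (induct n) (simp_all add: poly_funs.const poly_funs.mult)

lemma poly_funs_compose:
  assumes "F \<in> poly_funs X" "\<And>x. x \<in> X \<Longrightarrow> (\<lambda>s. x (\<gamma> s)) \<in> poly_funs Y"
  shows "(\<lambda>s. F (\<gamma> s)) \<in> poly_funs Y"
  using assms by (induct rule: poly_funs.induct) (simp_all add: poly_funs.const poly_funs.add poly_funs.mult)

lemmas poly_funs_closed = poly_funs.const poly_funs.add poly_funs.mult poly_funs_uminus poly_funs_diff
  poly_funs_sum poly_funs_prod poly_funs_power

abbreviation mat_coords :: "('k::comm_ring_1 ^ 3 ^ 3 \<Rightarrow> 'k) set"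
  where "mat_coords \<equiv> {\<lambda>g. g $ i $ j | i j. True}"

definition line_funs :: "('k::comm_ring_1 \<Rightarrow> 'k) set" where "line_funs = poly_funs {\<lambda>s. s}"
definition mat_funs :: "('k::comm_ring_1 ^ 3 ^ 3 \<Rightarrow> 'k) set"
  where "mat_funs = poly_funs mat_coords"

lemma line_funs_poly: "F \<in> line_funs \<Longrightarrow> \<exists>p. F = poly p"
  unfolding line_funs_def
proof (induct rule: poly_funs.induct)
  case (const c)
  show ?case by (rule exI[of _ "[:c:]"]) (simp add: fun_eq_iff)
next
  case (coord x)
  then show ?case by (intro exI[of _ "[:0, 1:]"]) (simp add: fun_eq_iff)
next
  case (add F G)
  then obtain p q where "F = poly p" "G = poly q" by blast
  then show ?case by (intro exI[of _ "p + q"]) (simp add: fun_eq_iff)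
next
  case (mult F G)
  then obtain p q where "F = poly p" "G = poly q" by blast
  then show ?case by (intro exI[of _ "p * q"]) (simp add: fun_eq_iff)
qed

lemma line_funs_finite_zeros:
  fixes F :: "'k::field \<Rightarrow> 'k"
  assumes "F \<in> line_funs" "F s0 \<noteq> 0"
  shows "finite {s. F s = 0}"
proof -
  obtain p where "F = poly p" using line_funs_poly[OF assms(1)] by blast
  then show ?thesis using assms(2) by (auto intro: poly_roots_finite)
qed

lemma line_funs_other_nonzero:
  fixes F :: "'k::field_char_0 \<Rightarrow> 'k"
  assumes "F \<in> line_funs" "F s0 \<noteq> 0"
  shows "\<exists>s. s \<noteq> s1 \<and> F s \<noteq> 0"
proof -
  have "infinite (UNIV :: 'k set)" by (rule infinite_UNIV_char_0)
  moreover have "finite ({s. F s = 0} \<union> {s1})"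
    using line_funs_finite_zeros[OF assms] by simp
  ultimately have "UNIV \<noteq> {s. F s = 0} \<union> {s1}" by metis
  then show ?thesis by blast
qed

lemma mat_funs_line:
  fixes F :: "'k::comm_ring_1 ^ 3 ^ 3 \<Rightarrow> 'k"
  assumes "F \<in> mat_funs" "\<And>i j. (\<lambda>s. \<gamma> s $ i $ j) \<in> line_funs"
  shows "(\<lambda>s. F (\<gamma> s)) \<in> line_funs"
  unfolding line_funs_def
  by (rule poly_funs_compose[OF assms(1)[unfolded mat_funs_def]])
     (use assms(2) in \<open>auto simp: line_funs_def\<close>)

text \<open>
  The matrix space is irreducible: on the line through \<open>g\<close> and \<open>h\<close> both functions become nonzero
  polynomials in one variable, and an infinite field has a point outside the roots of both.
\<close>

lemma mat_funs_common_nonzero: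
  fixes F G :: "'k::field_char_0 ^ 3 ^ 3 \<Rightarrow> 'k"
  assumes F: "F \<in> mat_funs" "F g \<noteq> 0" and G: "G \<in> mat_funs" "G h \<noteq> 0"
  shows "\<exists>x. F x \<noteq> 0 \<and> G x \<noteq> 0"
proof -
  define \<gamma> where "\<gamma> s = (\<chi> i j. (1 - s) * g $ i $ j + s * h $ i $ j)" for s
  have \<gamma>: "(\<lambda>s. \<gamma> s $ i $ j) \<in> line_funs" for i j
    by (simp add: \<gamma>_def line_funs_def poly_funs_closed poly_funs.coord)
  have "\<gamma> 0 = g" "\<gamma> 1 = h" by (simp_all add: \<gamma>_def vec_eq_iff)
  then have "finite {s. F (\<gamma> s) = 0}" "finite {s. G (\<gamma> s) = 0}"
    using line_funs_finite_zeros[OF mat_funs_line[OF F(1) \<gamma>], of 0]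
      line_funs_finite_zeros[OF mat_funs_line[OF G(1) \<gamma>], of 1] F(2) G(2) by auto
  moreover have "infinite (UNIV :: 'k set)" by (rule infinite_UNIV_char_0)
  ultimately have "UNIV \<noteq> {s. F (\<gamma> s) = 0} \<union> {s. G (\<gamma> s) = 0}"
    by (metis finite_Un)
  then show ?thesis by blast
qed

text \<open>
  The condition holds off the zero set of some nonzero polynomial in the entries.  Here the matrices range over
  the whole matrix space, so that openness in \<open>GL\<^sub>3\<close> comes in only at the end.
\<close>

definition generic :: "('k::field_char_0 ^ 3 ^ 3 \<Rightarrow> bool) \<Rightarrow> bool"
  where "generic \<Phi> \<longleftrightarrow> (\<exists>q\<in>mat_funs. (\<exists>h. q h \<noteq> 0) \<and> (\<forall>h. q h \<noteq> 0 \<longrightarrow> \<Phi> h))"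

lemma genericI: "q \<in> mat_funs \<Longrightarrow> q h0 \<noteq> 0 \<Longrightarrow> (\<And>h. q h \<noteq> 0 \<Longrightarrow> \<Phi> h) \<Longrightarrow> generic \<Phi>"
  unfolding generic_def by blast

lemma generic_conj:
  fixes \<Phi> \<Psi> :: "'k::field_char_0 ^ 3 ^ 3 \<Rightarrow> bool"
  assumes "generic \<Phi>" "generic \<Psi>"
  shows "generic (\<lambda>h. \<Phi> h \<and> \<Psi> h)"
proof -
  obtain q r g h where q: "q \<in> mat_funs" "q g \<noteq> 0" "\<And>h. q h \<noteq> 0 \<Longrightarrow> \<Phi> h"
    and r: "r \<in> mat_funs" "r h \<noteq> 0" "\<And>h. r h \<noteq> 0 \<Longrightarrow> \<Psi> h"
    using assms unfolding generic_def by blast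
  obtain x where x: "q x \<noteq> 0" "r x \<noteq> 0" using mat_funs_common_nonzero[OF q(1,2) r(1,2)] by blast
  show ?thesis
  proof (rule genericI)
    show "(\<lambda>h. q h * r h) \<in> mat_funs"
      using q(1) r(1) unfolding mat_funs_def by (rule poly_funs.mult)
    show "q x * r x \<noteq> 0" using x by simp
    show "\<Phi> h \<and> \<Psi> h" if "q h * r h \<noteq> 0" for h using q(3) r(3) that by simp
  qed
qed

lemma generic_True: "generic (\<lambda>_. True)"
  by (rule genericI[of "\<lambda>_. 1"]) (simp_all add: mat_funs_def poly_funs.const)

lemma generic_ball:
  assumes "finite A" "\<And>i. i \<in> A \<Longrightarrow> generic (\<Phi> i)"
  shows "generic (\<lambda>h. \<forall>i\<in>A. \<Phi> i h)"
  using assms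
proof (induct A rule: finite_induct)
  case empty
  show ?case by (simp add: generic_True)
next
  case (insert a A)
  then show ?case using generic_conj[of "\<Phi> a" "\<lambda>h. \<forall>i\<in>A. \<Phi> i h"] by simp
qed

lemma generic_ex: "generic \<Phi> \<Longrightarrow> \<exists>h. \<Phi> h"
  unfolding generic_def by blast

lemma eval_poly_mat_funs:
  "(\<lambda>g. eval_poly (\<lambda>c. c) (\<lambda>(i, j). g $ i $ j) p) \<in> mat_funs"
  unfolding eval_poly_def mat_funs_def
  by (rule poly_funs_sum, rule poly_funs.mult[OF poly_funs.const], rule poly_funs_prod, rule poly_funs_power)
     (auto intro!: poly_funs.coord)

lemma mat_funs_eval_poly:
  "F \<in> mat_funs \<Longrightarrow> \<exists>p. F = (\<lambda>g. eval_poly (\<lambda>c. c) (\<lambda>(i, j). g $ i $ j) p)"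
  unfolding mat_funs_def
proof (induct rule: poly_funs.induct)
  case (const c)
  show ?case by (rule exI[of _ "const c"]) simp
next
  case (coord x)
  then obtain i j where "x = (\<lambda>g. g $ i $ j)" by blast
  then show ?case by (intro exI[of _ "var (i, j)"]) simp
next
  case (add F G)
  then obtain p q where "F = (\<lambda>g. eval_poly (\<lambda>c. c) (\<lambda>(i, j). g $ i $ j) p)"
    "G = (\<lambda>g. eval_poly (\<lambda>c. c) (\<lambda>(i, j). g $ i $ j) q)" by blast
  then show ?case by (intro exI[of _ "p + q"]) (simp add: idh.eval_add)
next
  case (mult F G)
  then obtain p q where "F = (\<lambda>g. eval_poly (\<lambda>c. c) (\<lambda>(i, j). g $ i $ j) p)"
    "G = (\<lambda>g. eval_poly (\<lambda>c. c) (\<lambda>(i, j). g $ i $ j) q)" by blast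
  then show ?case by (intro exI[of _ "p * q"]) (simp add: idh.eval_mult)
qed

lemma det_mat_funs:
  assumes "\<And>i j. (\<lambda>g. M g $ i $ j) \<in> mat_funs"
  shows "(\<lambda>g. det (M g :: 'k::comm_ring_1 ^ 3 ^ 3)) \<in> mat_funs"
  unfolding det_def mat_funs_def
  by (rule poly_funs_sum, rule poly_funs.mult[OF poly_funs.const], rule poly_funs_prod)
     (use assms in \<open>simp add: mat_funs_def\<close>)

lemma mat_funs_entry: "(\<lambda>g. g $ i $ j) \<in> mat_funs"
  unfolding mat_funs_def by (auto intro: poly_funs.coord)

lemma matrix_inv_both:
  fixes g :: "'k::field ^ 3 ^ 3"
  assumes "invertible g"
  shows "g ** matrix_inv g = mat 1" "matrix_inv g ** g = mat 1"
  using someI_ex[OF assms[unfolded invertible_def]] by (simp_all add: matrix_inv_def)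

text \<open>
  By Cramer's rule the entries of the inverse are polynomials divided by the determinant, so a polynomial in
  the inverse becomes polynomial after multiplication by a power of the determinant.
\<close>

lemma mat_funs_matrix_inv:
  fixes F :: "'k::field ^ 3 ^ 3 \<Rightarrow> 'k"
  assumes "F \<in> mat_funs"
  shows "\<exists>G\<in>mat_funs. \<exists>N. \<forall>g. invertible g \<longrightarrow> G g = det g ^ N * F (matrix_inv g)"
  using assms[unfolded mat_funs_def]
proof (induct rule: poly_funs.induct)
  case (const c)
  show ?case by (rule bexI[of _ "\<lambda>_. c"], rule exI[of _ 0]) (simp_all add: mat_funs_def poly_funs.const)
next
  case (coord x)
  then obtain k l where x: "x = (\<lambda>g. g $ k $ l)" by blast
  define G where "G g = det (\<chi> i j. if j = k then (if i = l then 1 else 0) else g $ i $ j)"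
    for g :: "'k ^ 3 ^ 3"
  have entry: "(\<lambda>g. (\<chi> i j. if j = k then (if i = l then 1 else 0) else g $ i $ j) $ a $ b) \<in> mat_funs"
    for a b :: 3
    using mat_funs_entry[of a b] by (cases "b = k"; cases "a = l") (simp_all add: mat_funs_def poly_funs.const)
  have "G \<in> mat_funs"
    unfolding G_def by (rule det_mat_funs) (rule entry)
  moreover have "G g = det g ^ 1 * matrix_inv g $ k $ l" if g: "invertible g" for g
  proof -
    define c where "c = column l (matrix_inv g)"
    have "(g *v c) $ i = (if i = l then 1 else 0)" for i
    proof -
      have "(g *v c) $ i = (g ** matrix_inv g) $ i $ l"
        by (simp add: c_def column_def matrix_vector_mult_def matrix_matrix_mult_def)
      then show ?thesis by (simp add: matrix_inv_both[OF g] mat_def)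
    qed
    then have "G g = det (\<chi> i j. if j = k then (g *v c) $ i else g $ i $ j)"
      by (simp only: G_def)
    also have "\<dots> = c $ k * det g" by (rule cramer_lemma)
    finally show ?thesis by (simp add: c_def column_def)
  qed
  ultimately show ?case unfolding x by blast
next
  case (add F1 F2)
  then obtain G1 N1 G2 N2 where G: "G1 \<in> mat_funs" "G2 \<in> mat_funs"
    "\<forall>g. invertible g \<longrightarrow> G1 g = det g ^ N1 * F1 (matrix_inv g)"
    "\<forall>g. invertible g \<longrightarrow> G2 g = det g ^ N2 * F2 (matrix_inv g)" by blast
  have d: "det \<in> mat_funs" using det_mat_funs[of "\<lambda>g. g", OF mat_funs_entry] by simp
  show ?case
  proof (intro bexI exI allI impI)
    show "(\<lambda>g. det g ^ N2 * G1 g + det g ^ N1 * G2 g) \<in> mat_funs"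
      using G(1,2) d unfolding mat_funs_def
      by (intro poly_funs.add poly_funs.mult poly_funs_power)
    show "det g ^ N2 * G1 g + det g ^ N1 * G2 g = det g ^ (N1 + N2) * (F1 (matrix_inv g) + F2 (matrix_inv g))"
      if "invertible g" for g using G(3,4) that by (simp add: power_add algebra_simps)
  qed
next
  case (mult F1 F2)
  then obtain G1 N1 G2 N2 where G: "G1 \<in> mat_funs" "G2 \<in> mat_funs"
    "\<forall>g. invertible g \<longrightarrow> G1 g = det g ^ N1 * F1 (matrix_inv g)"
    "\<forall>g. invertible g \<longrightarrow> G2 g = det g ^ N2 * F2 (matrix_inv g)" by blast
  show ?case
  proof (intro bexI exI allI impI)
    show "(\<lambda>g. G1 g * G2 g) \<in> mat_funs"
      using G(1,2) unfolding mat_funs_def by (intro poly_funs.mult)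
    show "G1 g * G2 g = det g ^ (N1 + N2) * (F1 (matrix_inv g) * F2 (matrix_inv g))"
      if "invertible g" for g using G(3,4) that by (simp add: power_add algebra_simps)
  qed
qed
lemma generic_invertible: "generic (\<lambda>h :: 'k::field_char_0 ^ 3 ^ 3. invertible h)"
proof (rule genericI)
  show "det \<in> mat_funs" using det_mat_funs[of "\<lambda>g. g", OF mat_funs_entry] by simp
  show "det (mat 1 :: 'k ^ 3 ^ 3) \<noteq> 0" by simp
qed (simp add: invertible_det_nz)

lemma matrix_inv_unique:
  fixes g :: "'k::field ^ 3 ^ 3"
  assumes "g ** h = mat 1" "h ** g = mat 1"
  shows "matrix_inv g = h"
proof -
  have "invertible g" using assms unfolding invertible_def by blast
  from matrix_inv_both(2)[OF this] have "matrix_inv g ** (g ** h) = h"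
    by (simp add: matrix_mul_assoc)
  then show ?thesis using assms(1) by simp
qed

lemma generic_zariski_open:
  fixes U :: "('k::field_char_0 ^ 3 ^ 3) set"
  assumes "zariski_open_GL3 U" "U \<noteq> {}"
  shows "generic (\<lambda>g. g \<in> U)"
proof -
  obtain S where U: "U = {g. invertible g \<and> (\<exists>p\<in>S. eval_poly (\<lambda>c. c) (\<lambda>(i, j). g $ i $ j) p \<noteq> 0)}"
    using assms(1) unfolding zariski_open_GL3_def by blast
  obtain g p where g: "p \<in> S" "eval_poly (\<lambda>c. c) (\<lambda>(i, j). g $ i $ j) p \<noteq> 0"
    using assms(2) unfolding U by blast
  have "generic (\<lambda>g. eval_poly (\<lambda>c. c) (\<lambda>(i, j). g $ i $ j) p \<noteq> 0)"
    by (rule genericI[OF eval_poly_mat_funs g(2)])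
  from generic_conj[OF generic_invertible this] show ?thesis
    unfolding generic_def U using g(1) by blast
qed

text \<open>
  The linear forms that matter have the columns of \<open>g\<inverse>\<close> as coefficients, while the generic initial
  ideal quantifies over open sets of \<open>g\<close>; this passes from one to the other.
\<close>

lemma zariski_open_of_generic:
  fixes \<Phi> :: "'k::field_char_0 ^ 3 ^ 3 \<Rightarrow> bool"
  assumes "generic \<Phi>"
  shows "\<exists>U. zariski_open_GL3 U \<and> U \<noteq> {} \<and> (\<forall>g\<in>U. invertible g \<and> \<Phi> (matrix_inv g))"
proof -
  obtain q h0 where q: "q \<in> mat_funs" "q h0 \<noteq> 0" "\<And>h. q h \<noteq> 0 \<Longrightarrow> \<Phi> h"
    using assms unfolding generic_def by blast
  obtain G N where G: "G \<in> mat_funs" "\<And>g. invertible g \<Longrightarrow> G g = det g ^ N * q (matrix_inv g)"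
    using mat_funs_matrix_inv[OF q(1)] by blast
  obtain p where p: "G = (\<lambda>g. eval_poly (\<lambda>c. c) (\<lambda>(i, j). g $ i $ j) p)"
    using mat_funs_eval_poly[OF G(1)] by blast
  define U where "U = {g. invertible g \<and> G g \<noteq> 0}"
  have iff: "g \<in> U \<longleftrightarrow> invertible g \<and> q (matrix_inv g) \<noteq> 0" for g
    unfolding U_def using G(2)[of g] invertible_det_nz[of g] by auto
  have "generic (\<lambda>h. q h \<noteq> 0)" by (rule genericI[OF q(1,2)])
  from generic_ex[OF generic_conj[OF generic_invertible this]]
  obtain h where h: "invertible h" "q h \<noteq> 0" by blast
  have "matrix_inv (matrix_inv h) = h" "invertible (matrix_inv h)"
    using matrix_inv_both[OF h(1)] matrix_inv_unique unfolding invertible_def by blast+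
  then have "matrix_inv h \<in> U" unfolding iff using h by simp
  moreover have "zariski_open_GL3 U"
    unfolding zariski_open_GL3_def U_def p by (rule exI[of _ "{p}"]) simp
  ultimately show ?thesis using q(3) iff by blast
qed

section \<open>Independence in polynomial families of vectors\<close>

text \<open>
  Linear independence of an indexed family, so that a repeated vector counts as dependent.
\<close>

definition indep_family :: "'i set \<Rightarrow> ('i \<Rightarrow> ('v \<Rightarrow>\<^sub>0 nat) \<Rightarrow>\<^sub>0 'k::field) \<Rightarrow> bool"
  where "indep_family K v \<longleftrightarrow> (\<forall>c. (\<Sum>k\<in>K. scal (c k) (v k)) = 0 \<longrightarrow> (\<forall>k\<in>K. c k = 0))"

lemma indep_familyD: "indep_family K v \<Longrightarrow> (\<Sum>k\<in>K. scal (c k) (v k)) = 0 \<Longrightarrow> k \<in> K \<Longrightarrow> c k = 0"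
  unfolding indep_family_def by blast

lemma indep_family_iff:
  fixes v :: "'i \<Rightarrow> ('v \<Rightarrow>\<^sub>0 nat) \<Rightarrow>\<^sub>0 'k::field"
  assumes "finite K"
  shows "indep_family K v \<longleftrightarrow> inj_on v K \<and> vs.independent (v ` K)"
proof
  assume ind: "indep_family K v"
  have inj: "inj_on v K"
  proof (rule inj_onI, rule ccontr)
    fix a b assume ab: "a \<in> K" "b \<in> K" "v a = v b" "a \<noteq> b"
    define c where "c k = (if k = a then 1 else if k = b then -1 else (0::'k))" for k
    have "(\<Sum>k\<in>K. scal (c k) (v k)) = (\<Sum>k\<in>{a, b}. scal (c k) (v k))"
      using ab assms by (intro sum.mono_neutral_right) (auto simp: c_def)
    also have "\<dots> = 0" using ab by (simp add: c_def)
    finally have "c a = 0" using indep_familyD[OF ind, of c a] ab by blast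
    then show False by (simp add: c_def)
  qed
  moreover have "vs.independent (v ` K)"
  proof (rule vs.independent_if_scalars_zero)
    fix f x assume *: "(\<Sum>x\<in>v ` K. scal (f x) x) = 0" "x \<in> v ` K"
    have "(\<Sum>k\<in>K. scal (f (v k)) (v k)) = 0" using *(1) inj by (simp add: sum.reindex)
    then have "\<forall>k\<in>K. f (v k) = 0" using indep_familyD[OF ind, of "\<lambda>k. f (v k)"] by blast
    then show "f x = 0" using *(2) by blast
  qed (use assms in simp)
  ultimately show "inj_on v K \<and> vs.independent (v ` K)" by blast
next
  assume *: "inj_on v K \<and> vs.independent (v ` K)"
  show "indep_family K v"
    unfolding indep_family_def
  proof (intro allI impI ballI)
    fix c k assume c: "(\<Sum>k\<in>K. scal (c k) (v k)) = 0" and k: "k \<in> K"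
    have "(\<Sum>x\<in>v ` K. scal (c (inv_into K v x)) x) = 0"
      using * c by (simp add: sum.reindex)
    then have "c (inv_into K v (v k)) = 0"
      using vs.independentD[of "v ` K" "v ` K" "\<lambda>x. c (inv_into K v x)" "v k"] * k assms by auto
    then show "c k = 0" using * k by simp
  qed
qed

lemma indep_family_insert:
  assumes "finite K" "indep_family K v" "v t \<notin> vs.span (v ` K)"
  shows "indep_family (insert t K) v"
proof -
  have "v t \<notin> v ` K" using assms(3) by (rule contrapos_nn) (rule vs.span_base)
  moreover have "inj_on v K" "vs.independent (v ` K)" using assms(1,2) indep_family_iff by blast+
  ultimately have "inj_on v (insert t K)" "vs.independent (v ` insert t K)"
    using vs.independent_insertI[OF assms(3)] by auto
  then show ?thesis using assms(1) by (simp add: indep_family_iff)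
qed

text \<open>
  Independence is an open condition.  This is one step of Gaussian elimination per vector, with the
  divisions avoided: if the coordinate \<open>m\<close> of \<open>v k\<close> is nonzero at \<open>s0\<close>, clearing that coordinate in the other
  vectors leaves a polynomial family with one member fewer.
\<close>

lemma indep_family_open:
  fixes v :: "'i \<Rightarrow> 's \<Rightarrow> ('v \<Rightarrow>\<^sub>0 nat) \<Rightarrow>\<^sub>0 'k::field"
  assumes "finite K" "\<And>k m. k \<in> K \<Longrightarrow> (\<lambda>s. Poly_Mapping.lookup (v k s) m) \<in> poly_funs X"
    and "indep_family K (\<lambda>k. v k s0)"
  shows "\<exists>q\<in>poly_funs X. q s0 \<noteq> 0 \<and> (\<forall>s. q s \<noteq> 0 \<longrightarrow> indep_family K (\<lambda>k. v k s))"
  using assms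
proof (induct K arbitrary: v rule: finite_induct)
  case empty
  show ?case by (rule bexI[of _ "\<lambda>_. 1"]) (auto simp: indep_family_def intro: poly_funs.const)
next
  case (insert k K)
  have "v k s0 \<noteq> 0"
  proof
    assume 0: "v k s0 = 0"
    have "(\<Sum>j\<in>insert k K. scal (if j = k then 1 else 0) (v j s0)) = 0"
      using 0 by (intro sum.neutral) auto
    from indep_familyD[OF insert.prems(2) this, of k] show False by simp
  qed
  then obtain m where m: "Poly_Mapping.lookup (v k s0) m \<noteq> 0"
    by (metis poly_mapping_eqI lookup_zero)
  define a where "a s = Poly_Mapping.lookup (v k s) m" for s
  define b where "b j s = Poly_Mapping.lookup (v j s) m" for j s
  define v' where "v' j s = scal (a s) (v j s) - scal (b j s) (v k s)" for j s
  have a: "a \<in> poly_funs X" unfolding a_def by (rule insert.prems(1)) simp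
  have b: "b j \<in> poly_funs X" if "j \<in> K" for j unfolding b_def by (rule insert.prems(1)) (use that in simp)
  have v': "(\<lambda>s. Poly_Mapping.lookup (v' j s) n) \<in> poly_funs X" if "j \<in> K" for j n
    unfolding v'_def lookup_minus lookup_scal
    by (intro poly_funs_diff poly_funs.mult a b insert.prems(1)) (use that in auto)
  have expand: "(\<Sum>j\<in>K. scal (c j) (v' j s)) =
      scal (a s) (\<Sum>j\<in>K. scal (c j) (v j s)) - scal (\<Sum>j\<in>K. c j * b j s) (v k s)" for c s
    unfolding v'_def vs.scale_right_diff_distrib vs.scale_scale sum_subtractf
    by (simp add: vs.scale_sum_right vs.scale_sum_left mult.commute)
  have "indep_family K (\<lambda>j. v' j s0)"
    unfolding indep_family_def
  proof (intro allI impI ballI)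
    fix c j assume c: "(\<Sum>j\<in>K. scal (c j) (v' j s0)) = 0" and j: "j \<in> K"
    define c' where "c' i = (if i = k then - (\<Sum>j\<in>K. c j * b j s0) else a s0 * c i)" for i
    have "(\<Sum>j\<in>K. scal (c' j) (v j s0)) = scal (a s0) (\<Sum>j\<in>K. scal (c j) (v j s0))"
      unfolding vs.scale_sum_right using insert.hyps(2) by (intro sum.cong) (auto simp: c'_def)
    then have "(\<Sum>j\<in>insert k K. scal (c' j) (v j s0)) = 0"
      using insert.hyps c expand[of c s0] by (simp add: c'_def)
    from indep_familyD[OF insert.prems(2) this, of j] have "c' j = 0" using j by blast
    then show "c j = 0" using j insert.hyps(2) m by (auto simp: c'_def a_def split: if_splits)
  qed
  from insert.hyps(3)[OF v' this] obtain q where q: "q \<in> poly_funs X" "q s0 \<noteq> 0"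
    "\<And>s. q s \<noteq> 0 \<Longrightarrow> indep_family K (\<lambda>j. v' j s)" by blast
  show ?case
  proof (intro bexI conjI allI impI)
    \<comment> \<open>the condition must also keep the pivot invertible, or the elimination loses information\<close>
    show "(\<lambda>s. q s * a s) \<in> poly_funs X" by (intro poly_funs.mult q a)
    show "q s0 * a s0 \<noteq> 0" using q m by (simp add: a_def)
    fix s assume s: "q s * a s \<noteq> 0"
    show "indep_family (insert k K) (\<lambda>j. v j s)"
      unfolding indep_family_def
    proof (intro allI impI)
      fix c assume "(\<Sum>j\<in>insert k K. scal (c j) (v j s)) = 0"
      then have c: "scal (c k) (v k s) + (\<Sum>j\<in>K. scal (c j) (v j s)) = 0"
        using insert.hyps by simp
      have "Poly_Mapping.lookup (scal (c k) (v k s) + (\<Sum>j\<in>K. scal (c j) (v j s))) m = 0"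
        by (simp add: c)
      then have "c k * a s + (\<Sum>j\<in>K. c j * b j s) = 0"
        by (simp add: lookup_add lookup_sum a_def b_def)
      then have B: "(\<Sum>j\<in>K. c j * b j s) = - (c k * a s)" by (simp add: eq_neg_iff_add_eq_0 add.commute)
      from c have S: "(\<Sum>j\<in>K. scal (c j) (v j s)) = - scal (c k) (v k s)"
        by (simp add: eq_neg_iff_add_eq_0 add.commute)
      have "(\<Sum>j\<in>K. scal (c j) (v' j s)) = 0"
        unfolding expand B S by (simp add: mult.commute)
      then have K: "\<forall>j\<in>K. c j = 0" using q(3)[of s] s unfolding indep_family_def by simp
      then have "c k * a s = 0" using B by simp
      then show "\<forall>j\<in>insert k K. c j = 0" using K s by auto
    qed
  qed
qed

text \<open>
  Polynomial-valued maps whose coefficients are polynomial functions of the parameter.  The generation by constants,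
  scaling and addition makes closure under linear maps an immediate induction.
\<close>

inductive_set poly_fams :: "('s \<Rightarrow> 'k::field) set \<Rightarrow> ('s \<Rightarrow> ('v \<Rightarrow>\<^sub>0 nat) \<Rightarrow>\<^sub>0 'k) set" for X where
  const: "(\<lambda>s. v) \<in> poly_fams X"
| scale: "a \<in> poly_funs X \<Longrightarrow> F \<in> poly_fams X \<Longrightarrow> (\<lambda>s. scal (a s) (F s)) \<in> poly_fams X"
| add: "F \<in> poly_fams X \<Longrightarrow> G \<in> poly_fams X \<Longrightarrow> (\<lambda>s. F s + G s) \<in> poly_fams X"

lemma poly_fams_lookup: "F \<in> poly_fams X \<Longrightarrow> (\<lambda>s. Poly_Mapping.lookup (F s) m) \<in> poly_funs X"
  by (induct rule: poly_fams.induct) (simp_all add: lookup_add poly_funs.const poly_funs.add poly_funs.mult)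

lemma poly_fams_linear:
  assumes "F \<in> poly_fams X" "Vector_Spaces.linear scal scal P"
  shows "(\<lambda>s. P (F s)) \<in> poly_fams X"
proof -
  interpret P: Vector_Spaces.linear scal scal P by (rule assms(2))
  show ?thesis
    using assms(1)
    by (induct rule: poly_fams.induct) (simp_all add: P.add P.scale poly_fams.intros)
qed

lemma poly_fams_mult:
  assumes "F \<in> poly_fams X" "G \<in> poly_fams X"
  shows "(\<lambda>s. F s * G s) \<in> poly_fams X"
  using assms(1)
proof (induct rule: poly_fams.induct)
  case (const v)
  show ?case
    using assms(2)
    by (induct rule: poly_fams.induct) (simp_all add: scal_mult distrib_left poly_fams.intros)
qed (simp_all add: scal_mult distrib_right poly_fams.intros)

lemma poly_fams_sum: "(\<And>i. i \<in> A \<Longrightarrow> F i \<in> poly_fams X) \<Longrightarrow> (\<lambda>s. \<Sum>i\<in>A. F i s) \<in> poly_fams X"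
  by (induct A rule: infinite_finite_induct) (simp_all add: poly_fams.const poly_fams.add)

lemma poly_fams_power: "F \<in> poly_fams X \<Longrightarrow> (\<lambda>s. F s ^ n) \<in> poly_fams X"
  by (induct n) (simp_all add: poly_fams.const poly_fams_mult)

lemma poly_fams_diff: "F \<in> poly_fams X \<Longrightarrow> G \<in> poly_fams X \<Longrightarrow> (\<lambda>s. F s - G s) \<in> poly_fams X"
  using poly_fams.add[OF _ poly_fams.scale[OF poly_funs.const[of "-1"]], of F X G] by simp

section \<open>Dimensions of finitely spanned spaces\<close>

lemma span_lincomb: "(\<And>k. k \<in> K \<Longrightarrow> v k \<in> vs.span S) \<Longrightarrow> (\<Sum>k\<in>K. scal (c k) (v k)) \<in> vs.span S"
  by (rule vs.span_sum, rule vs.span_scale) blast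

lemma span_image_lincomb:
  fixes v :: "'i \<Rightarrow> ('v \<Rightarrow>\<^sub>0 nat) \<Rightarrow>\<^sub>0 'k::field"
  assumes "y \<in> vs.span (v ` K)" "finite K"
  shows "\<exists>c. y = (\<Sum>k\<in>K. scal (c k) (v k))"
  using assms(1)
proof (induct rule: vs.span_induct_alt)
  case base
  show ?case by (rule exI[of _ "\<lambda>_. 0"]) simp
next
  case (step a x y)
  then obtain j c where j: "j \<in> K" "x = v j" and c: "y = (\<Sum>k\<in>K. scal (c k) (v k))" by blast
  have "(\<Sum>k\<in>K. scal (c k + (if k = j then a else 0)) (v k)) = y + (\<Sum>k\<in>K. if k = j then scal a x else 0)"
    unfolding c sum.distrib[symmetric] using j by (intro sum.cong) (auto simp: vs.scale_left_distrib)
  then have "scal a x + y = (\<Sum>k\<in>K. scal (c k + (if k = j then a else 0)) (v k))"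
    using j(1) assms(2) by simp
  then show ?case by (rule exI[of _ "\<lambda>k. c k + (if k = j then a else 0)"])
qed

lemma dim_mono_finite:
  assumes "S \<subseteq> vs.span T" "finite T"
  shows "vs.dim S \<le> vs.dim T"
proof -
  obtain B where B: "B \<subseteq> T" "vs.independent B" "T \<subseteq> vs.span B" "card B = vs.dim T"
    by (rule vs.basis_exists)
  have "S \<subseteq> vs.span B" using assms(1) vs.span_mono[OF B(3)] by (simp add: vs.span_span)
  then show ?thesis using vs.dim_le_card[of S B] B finite_subset[OF B(1) assms(2)] by simp
qed

text \<open>
  The ambient space of all polynomials is infinite-dimensional, so the statements about dimension have to be
  relativised to finite spanning sets.
\<close>

lemma dim_insert_finite:
  assumes "finite S"
  shows "vs.dim (insert x S) = (if x \<in> vs.span S then vs.dim S else Suc (vs.dim S))"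
proof (cases "x \<in> vs.span S")
  case True
  then have "vs.span (insert x S) = vs.span S" by (rule vs.span_redundant)
  then show ?thesis using True vs.span_eq_dim by auto
next
  case False
  obtain B where B: "B \<subseteq> S" "vs.independent B" "S \<subseteq> vs.span B" "card B = vs.dim S"
    by (rule vs.basis_exists)
  have fin: "finite B" using B(1) assms finite_subset by blast
  have x: "x \<notin> vs.span B" using False vs.span_mono[OF B(1)] by blast
  then have "x \<notin> B" using vs.span_base by blast
  have "vs.dim (insert x S) = card (insert x B)"
  proof (rule vs.dim_unique)
    show "vs.independent (insert x B)" using x B(2) by (rule vs.independent_insertI)
    show "insert x S \<subseteq> vs.span (insert x B)"
      using B(3) vs.span_mono[of B "insert x B"] vs.span_base[of x "insert x B"] by auto
  qed (use B in auto)
  then show ?thesis using False fin \<open>x \<notin> B\<close> B(4) by simp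
qed

lemma indep_family_card_le:
  assumes "finite K" "indep_family K v" "v ` K \<subseteq> vs.span T" "finite T"
  shows "card K \<le> vs.dim T"
proof -
  have *: "inj_on v K" "vs.independent (v ` K)" using assms(1,2) indep_family_iff by blast+
  then have "card K = vs.dim (v ` K)" by (simp add: card_image vs.dim_eq_card_independent)
  also have "\<dots> \<le> vs.dim T" by (rule dim_mono_finite[OF assms(3,4)])
  finally show ?thesis .
qed

lemma indep_subfamily:
  fixes v :: "'i \<Rightarrow> ('v \<Rightarrow>\<^sub>0 nat) \<Rightarrow>\<^sub>0 'k::field"
  assumes D: "finite D"
  obtains K where "K \<subseteq> D" "finite K" "indep_family K v" "v ` D \<subseteq> vs.span (v ` K)"
    "card K = vs.dim (v ` D)"
proof -
  obtain B where B: "B \<subseteq> v ` D" "vs.independent B" "v ` D \<subseteq> vs.span B" "card B = vs.dim (v ` D)"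
    by (rule vs.basis_exists)
  obtain K where K: "K \<subseteq> D" "inj_on v K" "B = v ` K"
    using B(1) by (meson subset_image_inj)
  have "finite K" using K(1) D by (rule finite_subset)
  then show thesis
    using that[OF K(1)] B K indep_family_iff[of K v] by (simp add: card_image)
qed

section \<open>The grading\<close>

lemma mdeg_add: "mdeg (m + n) = mdeg m + mdeg n"
  by (simp add: mdeg_def lookup_add sum.distrib)

lemma mdeg_alt: "mdeg m = Poly_Mapping.lookup m 1 + Poly_Mapping.lookup m 2 + Poly_Mapping.lookup m 3"
  by (simp add: mdeg_def sum_3)

definition mon :: "nat \<Rightarrow> nat \<Rightarrow> nat \<Rightarrow> monom3"
  where "mon a b c = Poly_Mapping.single 1 a + Poly_Mapping.single 2 b + Poly_Mapping.single 3 c"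

lemma lookup_mon [simp]:
  "Poly_Mapping.lookup (mon a b c) 1 = a" "Poly_Mapping.lookup (mon a b c) 2 = b"
  "Poly_Mapping.lookup (mon a b c) 3 = c"
  by (simp_all add: mon_def lookup_add lookup_single)

lemma monom3_eqI:
  "Poly_Mapping.lookup m 1 = Poly_Mapping.lookup n 1 \<Longrightarrow> Poly_Mapping.lookup m 2 = Poly_Mapping.lookup n 2 \<Longrightarrow>
   Poly_Mapping.lookup m 3 = Poly_Mapping.lookup n 3 \<Longrightarrow> m = (n :: monom3)"
  by (rule poly_mapping_eqI) (metis exhaust_3)

lemma mdeg_mon [simp]: "mdeg (mon a b c) = a + b + c"
  by (simp add: mdeg_alt)

definition monoms :: "nat \<Rightarrow> monom3 set" where "monoms d = {m. mdeg m = d}"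

lemma finite_monoms [simp]: "finite (monoms d)"
proof (rule finite_subset)
  show "monoms d \<subseteq> (\<lambda>(a, b, c). mon a b c) ` ({..d} \<times> {..d} \<times> {..d})"
  proof
    fix m assume "m \<in> monoms d"
    moreover have "m = mon (Poly_Mapping.lookup m 1) (Poly_Mapping.lookup m 2) (Poly_Mapping.lookup m 3)"
      by (rule monom3_eqI) simp_all
    ultimately show "m \<in> (\<lambda>(a, b, c). mon a b c) ` ({..d} \<times> {..d} \<times> {..d})"
      by (intro image_eqI[of _ _ "(Poly_Mapping.lookup m 1, Poly_Mapping.lookup m 2, Poly_Mapping.lookup m 3)"])
        (auto simp: monoms_def mdeg_alt)
  qed
qed simp

lemma forms_iff: "f \<in> forms d \<longleftrightarrow> Poly_Mapping.keys f \<subseteq> monoms d"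
  by (auto simp: forms_def monoms_def)

lemma forms_lookup: "f \<in> forms d \<longleftrightarrow> (\<forall>m. mdeg m \<noteq> d \<longrightarrow> Poly_Mapping.lookup f m = 0)"
  by (auto simp: forms_def in_keys_iff)

lemma subspace_forms: "vs.subspace (forms d :: 'k::field poly3 set)"
  by (rule vs.subspaceI) (auto simp: forms_lookup lookup_add)

lemma forms_mult: "f \<in> forms i \<Longrightarrow> g \<in> forms j \<Longrightarrow> f * g \<in> forms (i + j)" for f :: "'k::comm_ring_1 poly3"
  using keys_mult[of f g] by (auto simp: forms_def mdeg_add)

lemma monomial_forms [simp]: "monomial m \<in> forms (mdeg m)"
  by (auto simp: monomial_def forms_def split: if_splits)

lemma monomial_monoms: "m \<in> monoms d \<Longrightarrow> monomial m \<in> forms d"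
  by (auto simp: monoms_def)

lemma one_forms [simp]: "1 \<in> forms 0"
  by (auto simp: forms_def mdeg_def)

lemma var_forms [simp]: "var i \<in> forms 1"
proof -
  have "mdeg (Poly_Mapping.single i 1) = 1"
    by (simp add: mdeg_def lookup_single when_def)
  then show ?thesis by (auto simp: var_def forms_def split: if_splits)
qed

lemma forms_power: "f \<in> forms i \<Longrightarrow> f ^ n \<in> forms (n * i)" for f :: "'k::comm_ring_1 poly3"
  by (induct n) (auto simp: forms_mult)

lemma forms_expand: "f \<in> forms d \<Longrightarrow> f = (\<Sum>m\<in>monoms d. scal (Poly_Mapping.lookup f m) (monomial m))"
  for f :: "'k::comm_ring_1 poly3"
  by (rule poly_eq_sum_monomials) (auto simp: forms_iff)

lemma forms_eq_span: "forms d = vs.span (monomial ` monoms d :: 'k::field poly3 set)"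
proof
  show "forms d \<subseteq> vs.span (monomial ` monoms d :: 'k poly3 set)"
  proof
    fix f :: "'k poly3" assume f: "f \<in> forms d"
    show "f \<in> vs.span (monomial ` monoms d)"
      by (subst forms_expand[OF f], rule span_lincomb, rule vs.span_base) blast
  qed
  show "vs.span (monomial ` monoms d :: 'k poly3 set) \<subseteq> forms d"
    by (rule vs.span_minimal[OF _ subspace_forms]) (auto simp: monoms_def)
qed

lemma dim_image_forms:
  fixes Q :: "'k::field poly3 \<Rightarrow> 'k poly3"
  assumes "Vector_Spaces.linear scal scal Q"
  shows "vs.dim (Q ` forms d) = vs.dim ((\<lambda>m. Q (monomial m)) ` monoms d)"
proof -
  interpret Q: Vector_Spaces.linear scal scal Q by (rule assms)
  have "vs.span ((\<lambda>m. Q (monomial m)) ` monoms d) = Q ` forms d"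
    unfolding forms_eq_span image_image[symmetric, of Q monomial] by (rule Q.span_image)
  then show ?thesis by (metis vs.dim_span)
qed

definition hcomp :: "nat \<Rightarrow> 'k::comm_ring_1 poly3 \<Rightarrow> 'k poly3"
  where "hcomp d f = (\<Sum>m | m \<in> Poly_Mapping.keys f \<and> mdeg m = d. Poly_Mapping.single m (Poly_Mapping.lookup f m))"

lemma lookup_hcomp [simp]: "Poly_Mapping.lookup (hcomp d f) n = (if mdeg n = d then Poly_Mapping.lookup f n else 0)"
proof -
  have "Poly_Mapping.lookup (hcomp d f) n =
      (\<Sum>m | m \<in> Poly_Mapping.keys f \<and> mdeg m = d. if m = n then Poly_Mapping.lookup f n else 0)"
    unfolding hcomp_def lookup_sum by (intro sum.cong) (auto simp: lookup_single when_def)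
  then show ?thesis by (auto simp: in_keys_iff)
qed

lemma hcomp_add: "hcomp d (f + g) = hcomp d f + hcomp d g"
  by (rule poly_mapping_eqI) (simp add: lookup_add)

lemma hcomp_scal: "hcomp d (scal c f) = scal c (hcomp d f)"
  by (rule poly_mapping_eqI) simp

lemma hcomp_sum: "hcomp d (\<Sum>i\<in>A. f i) = (\<Sum>i\<in>A. hcomp d (f i))"
  by (rule poly_mapping_eqI) (simp add: lookup_sum)

lemma hcomp_of_form: "f \<in> forms e \<Longrightarrow> hcomp d f = (if d = e then f else 0)"
  by (rule poly_mapping_eqI) (auto simp: forms_lookup)

lemma hcomp_mult_below:
  fixes y :: "'k::comm_ring_1 poly3"
  assumes "y \<in> forms e" "d < e"
  shows "hcomp d (c * y) = 0"
proof -
  have "hcomp d (Poly_Mapping.single m a * y) = 0" for m a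
  proof -
    have "Poly_Mapping.single m a \<in> forms (mdeg m)" by (auto simp: forms_def split: if_splits)
    from hcomp_of_form[OF forms_mult[OF this assms(1)], of d] show ?thesis using assms(2) by simp
  qed
  moreover have "c * y = (\<Sum>m\<in>Poly_Mapping.keys c. Poly_Mapping.single m (Poly_Mapping.lookup c m) * y)"
    by (subst poly_mapping_sum_singles[of "Poly_Mapping.keys c" c]) (simp_all add: sum_distrib_right)
  ultimately show ?thesis by (simp add: hcomp_sum)
qed

text \<open>
  A multiple of a homogeneous generator is a sum of multiples by single terms, each of which is
  homogeneous and stays in the ideal.
\<close>

lemma homogeneous_ideal_hcomp:
  fixes I :: "'k::comm_ring_1 poly3 set"
  assumes "homogeneous_ideal I"
  shows "is_ideal I" "f \<in> I \<Longrightarrow> hcomp d f \<in> I"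
proof -
  obtain G where G: "G \<subseteq> (\<Union>d. forms d)" "I = ideal_gen G"
    using assms unfolding homogeneous_ideal_def by blast
  show I: "is_ideal I" unfolding G(2) by simp
  assume f: "f \<in> I"
  show "hcomp d f \<in> I"
    using f unfolding G(2)
  proof (induct rule: idl.span_induct_alt)
    case base
    have "hcomp d 0 = (0 :: 'k poly3)" by (rule poly_mapping_eqI) simp
    then show ?case by (simp add: idl.span_zero)
  next
    case (step c x y)
    obtain e where x: "x \<in> forms e" using step(1) G(1) by blast
    have "hcomp d (Poly_Mapping.single m a * x) \<in> idl.span G" for m a
    proof -
      have "Poly_Mapping.single m a \<in> forms (mdeg m)" by (auto simp: forms_def split: if_splits)
      from hcomp_of_form[OF forms_mult[OF this x], of d] show ?thesis
        using idl.span_scale[OF idl.span_base[OF step(1)], of "Poly_Mapping.single m a"]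
        by (auto simp: idl.span_zero)
    qed
    moreover have "c * x = (\<Sum>m\<in>Poly_Mapping.keys c. Poly_Mapping.single m (Poly_Mapping.lookup c m) * x)"
      by (subst poly_mapping_sum_singles[of "Poly_Mapping.keys c" c]) (simp_all add: sum_distrib_right)
    ultimately have "hcomp d (c * x) \<in> idl.span G"
      by (simp add: hcomp_sum idl.span_sum)
    then show ?case using step(2) by (simp add: hcomp_add idl.span_add)
  qed
qed

lemma ideal_subspace: "is_ideal I \<Longrightarrow> vs.subspace (I :: 'k::field poly3 set)"
  by (rule vs.subspaceI)
    (auto simp: scal_def intro: idl.subspace_0 idl.subspace_add idl.subspace_scale)

text \<open>
  Extend a basis of \<open>I\<close> to the whole space and kill its members.  The map replaces the quotient by \<open>I\<close>, so that
  residue classes can be handled as vectors of the polynomial ring itself.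
\<close>

lemma exists_linear_with_kernel:
  fixes I :: "(('v \<Rightarrow>\<^sub>0 nat) \<Rightarrow>\<^sub>0 'k::field) set"
  assumes "vs.subspace I"
  shows "\<exists>P :: (('v \<Rightarrow>\<^sub>0 nat) \<Rightarrow>\<^sub>0 'k) \<Rightarrow> (('v \<Rightarrow>\<^sub>0 nat) \<Rightarrow>\<^sub>0 'k). Vector_Spaces.linear scal scal P \<and> (\<forall>f. P f = 0 \<longleftrightarrow> f \<in> I)"
proof -
  obtain B where B: "B \<subseteq> I" "vs.independent B" "I \<subseteq> vs.span B"
    using vs.basis_exists[of I] by metis
  have I: "I = vs.span B" using B vs.span_minimal[OF B(1) assms] by blast
  define C where "C = vs.extend_basis B"
  have C: "B \<subseteq> C" "vs.independent C" "vs.span C = UNIV"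
    unfolding C_def using B(2)
    by (simp_all add: vs.extend_basis_superset vs.independent_extend_basis vs.span_extend_basis)
  define P where "P = vp.construct C (\<lambda>b. if b \<in> B then 0 else b)"
  have lin: "Vector_Spaces.linear scal scal P" unfolding P_def by (rule vp.linear_construct[OF C(2)])
  interpret P: Vector_Spaces.linear scal scal P by (rule lin)
  have P: "P b = (if b \<in> B then 0 else b)" if "b \<in> C" for b
    unfolding P_def by (rule vp.construct_basis[OF C(2) that])
  have 0: "P x = 0" if "x \<in> vs.span B" for x
    using that by (induct rule: vs.span_induct_alt) (use P C(1) in \<open>auto simp: P.add P.scale P.zero\<close>)
  have id: "P y = y" if "y \<in> vs.span (C - B)" for y
    using that by (induct rule: vs.span_induct_alt) (use P in \<open>auto simp: P.add P.scale P.zero\<close>)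
  have "f \<in> I" if "P f = 0" for f
  proof -
    have "f \<in> vs.span (B \<union> (C - B))" using C(1,3) by (simp add: Un_absorb1)
    then obtain x y where xy: "f = x + y" "x \<in> vs.span B" "y \<in> vs.span (C - B)"
      unfolding vs.span_Un by blast
    then have "y = 0" using that 0[of x] id[of y] by (simp add: P.add)
    then show ?thesis using xy I by simp
  qed
  moreover have "P f = 0" if "f \<in> I" for f using 0 that unfolding I .
  ultimately show ?thesis using lin by blast
qed

section \<open>The quotient by a homogeneous ideal\<close>

text \<open>
  The image of \<open>P\<close> stands for \<open>R/I\<close>.  Only the vector space structure is
  transported: the graded pieces are the images of the spaces of forms, and products are formed before applying \<open>P\<close>.
\<close>

locale homogeneous_quotient =
  fixes I :: "'k::field_char_0 poly3 set" and P :: "'k poly3 \<Rightarrow> 'k poly3"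
  assumes ideal: "is_ideal I" and hcomp_ideal: "f \<in> I \<Longrightarrow> hcomp d f \<in> I"
    and linear_P: "Vector_Spaces.linear scal scal P" and kernel: "P f = 0 \<longleftrightarrow> f \<in> I"
begin

sublocale P: Vector_Spaces.linear scal scal P by (rule linear_P)

lemma P_eq_iff: "P f = P g \<longleftrightarrow> f - g \<in> I"
  using kernel[of "f - g"] by (simp add: P.diff)

lemma class_eq_iff: "cong_mod I `` {f} = cong_mod I `` {g} \<longleftrightarrow> P f = P g"
proof
  have "f \<in> cong_mod I `` {f}" using idl.subspace_0[OF ideal] by (simp add: cong_mod_def)
  moreover assume "cong_mod I `` {f} = cong_mod I `` {g}"
  ultimately have "f \<in> cong_mod I `` {g}" by metis
  then have "g - f \<in> I" by (simp add: cong_mod_def)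
  then show "P f = P g" by (metis P_eq_iff)
next
  assume *: "P f = P g"
  have "cong_mod I `` {f} = {x. P f = P x}" for f by (auto simp: cong_mod_def P_eq_iff)
  then show "cong_mod I `` {f} = cong_mod I `` {g}" using * by simp
qed

lemma P_form_span: "f \<in> forms d \<Longrightarrow> P f \<in> vs.span ((\<lambda>m. P (monomial m)) ` monoms d)"
  by (subst forms_expand[of f d], assumption, unfold P.sum P.scale, rule span_lincomb, rule vs.span_base) blast

lemma dim_forms: "vs.dim (P ` forms d) = vs.dim ((\<lambda>m. P (monomial m)) ` monoms d)"
  by (rule dim_image_forms[OF linear_P])

text \<open>
  Translates the description of a basis of \<open>(R/I)\<^sub>d\<close> by unique coordinates into linear algebra:
  injectivity is independence, surjectivity is spanning.
\<close>

lemma coordinates_bij_iff: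
  fixes n :: nat
  assumes b: "\<forall>i<n. b i \<in> forms d"
  shows "bij_betw (\<lambda>c. cong_mod I `` {\<Sum>i<n. const (c i) * b i}) ({..<n} \<rightarrow>\<^sub>E UNIV) (quot_part I d) \<longleftrightarrow>
    indep_family {..<n} (\<lambda>i. P (b i)) \<and> P ` forms d \<subseteq> vs.span ((\<lambda>i. P (b i)) ` {..<n})"
    (is "bij_betw ?F ?E ?Q \<longleftrightarrow> ?ind \<and> ?span")
proof -
  have PF: "P (\<Sum>i<n. const (c i) * b i) = (\<Sum>i<n. scal (c i) (P (b i)))" for c
    by (simp add: scal_def[symmetric] P.sum P.scale)
  have inj: "inj_on ?F ?E \<longleftrightarrow> ?ind"
  proof
    assume inj: "inj_on ?F ?E"
    show ?ind
      unfolding indep_family_def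
    proof (intro allI impI ballI)
      fix c k assume c: "(\<Sum>i<n. scal (c i) (P (b i))) = 0" and k: "k \<in> {..<n}"
      have "restrict c {..<n} = restrict (\<lambda>_. 0) {..<n}"
      proof (rule inj_onD[OF inj])
        show "?F (restrict c {..<n}) = ?F (restrict (\<lambda>_. 0) {..<n})"
          unfolding class_eq_iff PF using c by simp
      qed simp_all
      then show "c k = 0" using k by (metis restrict_apply')
    qed
  next
    assume ind: ?ind
    show "inj_on ?F ?E"
    proof (rule inj_onI)
      fix c c' assume c: "c \<in> ?E" "c' \<in> ?E" "?F c = ?F c'"
      then have "(\<Sum>i<n. scal (c i - c' i) (P (b i))) = 0"
        unfolding class_eq_iff PF by (simp add: vs.scale_left_diff_distrib sum_subtractf)
      then have "c i - c' i = 0" if "i < n" for i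
        using indep_familyD[OF ind, of "\<lambda>i. c i - c' i" i] that by simp
      then show "c = c'" using c(1,2) by (intro PiE_ext[of c "{..<n}" "\<lambda>_. UNIV"]) auto
    qed
  qed
  have "(\<Sum>i<n. const (c i) * b i) \<in> forms d" for c
    unfolding scal_def[symmetric]
    using b by (intro vs.subspace_sum[OF subspace_forms] vs.subspace_scale[OF subspace_forms]) auto
  then have sub: "?F ` ?E \<subseteq> ?Q" unfolding quot_part_def by blast
  have surj: "?Q \<subseteq> ?F ` ?E \<longleftrightarrow> ?span"
  proof
    assume *: "?Q \<subseteq> ?F ` ?E"
    show ?span
    proof
      fix x assume "x \<in> P ` forms d"
      then obtain f where f: "f \<in> forms d" "x = P f" by blast
      then have "cong_mod I `` {f} \<in> ?F ` ?E" using * unfolding quot_part_def by blast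
      then obtain c where "P f = (\<Sum>i<n. scal (c i) (P (b i)))"
        by (auto simp: class_eq_iff PF)
      moreover have "(\<Sum>i<n. scal (c i) (P (b i))) \<in> vs.span ((\<lambda>i. P (b i)) ` {..<n})"
        by (rule span_lincomb, rule vs.span_base) blast
      ultimately show "x \<in> vs.span ((\<lambda>i. P (b i)) ` {..<n})" using f(2) by simp
    qed
  next
    assume *: ?span
    show "?Q \<subseteq> ?F ` ?E"
    proof
      fix C assume "C \<in> ?Q"
      then obtain f where f: "f \<in> forms d" "C = cong_mod I `` {f}" unfolding quot_part_def by blast
      have "P f \<in> vs.span ((\<lambda>i. P (b i)) ` {..<n})" using * f(1) by blast
      from span_image_lincomb[OF this finite_lessThan] obtain c where c: "P f = (\<Sum>i<n. scal (c i) (P (b i)))" ..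
      have "C = ?F (restrict c {..<n})" unfolding f(2) class_eq_iff PF by (simp add: c)
      then show "C \<in> ?F ` ?E" by (rule image_eqI[where x = "restrict c {..<n}"]) (rule restrict_PiE_iff[THEN iffD2], simp)
    qed
  qed
  have "?F ` ?E = ?Q \<longleftrightarrow> ?Q \<subseteq> ?F ` ?E" unfolding set_eq_subset using sub by (simp only: simp_thms)
  then show ?thesis unfolding bij_betw_def inj surj by (rule arg_cong)
qed

lemma hilbert_fun_eq_dim: "hilbert_fun I d = vs.dim (P ` forms d)"
proof -
  let ?v = "\<lambda>m. P (monomial m)"
  obtain K where K: "K \<subseteq> monoms d" "finite K" "indep_family K ?v"
    "?v ` monoms d \<subseteq> vs.span (?v ` K)" "card K = vs.dim (?v ` monoms d)"
    by (rule indep_subfamily[OF finite_monoms])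
  obtain e where e: "bij_betw e {..<card K} K"
    using ex_bij_betw_nat_finite[OF K(2)] by (auto simp: atLeast0LessThan)
  have im: "(\<lambda>i. P (monomial (e i))) ` {..<card K} = ?v ` K"
    using e unfolding bij_betw_def image_image[symmetric, of ?v e] by simp
  have "inj_on (\<lambda>i. P (monomial (e i))) {..<card K}"
    using comp_inj_on[of e "{..<card K}" ?v] e K(2,3) indep_family_iff[OF K(2), of ?v]
    by (simp add: bij_betw_def o_def)
  then have ind: "indep_family {..<card K} (\<lambda>i. P (monomial (e i)))"
    using K(2,3) indep_family_iff[OF K(2), of ?v] by (simp add: indep_family_iff im)
  have forms: "\<forall>i<card K. monomial (e i) \<in> forms d"
    using e K(1) monomial_monoms unfolding bij_betw_def by blast
  have span: "P ` forms d \<subseteq> vs.span ((\<lambda>i. P (monomial (e i))) ` {..<card K})"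
    unfolding im using P_form_span vs.span_mono[OF K(4)] by (auto simp: vs.span_span)
  show ?thesis
    unfolding hilbert_fun_def
  proof (rule the_equality)
    show "\<exists>b. (\<forall>i<vs.dim (P ` forms d). b i \<in> forms d) \<and>
      bij_betw (\<lambda>c. cong_mod I `` {\<Sum>i<vs.dim (P ` forms d). const (c i) * b i})
        ({..<vs.dim (P ` forms d)} \<rightarrow>\<^sub>E UNIV) (quot_part I d)"
    proof (intro exI conjI)
      have n: "vs.dim (P ` forms d) = card K" by (simp add: dim_forms K(5))
      show "\<forall>i<vs.dim (P ` forms d). monomial (e i) \<in> forms d" unfolding n by (rule forms)
      show "bij_betw (\<lambda>c. cong_mod I `` {\<Sum>i<vs.dim (P ` forms d). const (c i) * monomial (e i)})
        ({..<vs.dim (P ` forms d)} \<rightarrow>\<^sub>E UNIV) (quot_part I d)"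
        unfolding n coordinates_bij_iff[OF forms] using ind span by (rule conjI)
    qed
  next
    fix n :: nat assume "\<exists>b. (\<forall>i<n. b i \<in> forms d) \<and>
      bij_betw (\<lambda>c. cong_mod I `` {\<Sum>i<n. const (c i) * b i}) ({..<n} \<rightarrow>\<^sub>E UNIV) (quot_part I d)"
    then obtain b where b: "\<forall>i<n. b i \<in> forms d" and
      bij: "bij_betw (\<lambda>c. cong_mod I `` {\<Sum>i<n. const (c i) * b i}) ({..<n} \<rightarrow>\<^sub>E UNIV) (quot_part I d)"
      by (elim exE conjE)
    have *: "indep_family {..<n} (\<lambda>i. P (b i))" "P ` forms d \<subseteq> vs.span ((\<lambda>i. P (b i)) ` {..<n})"
      using bij[unfolded coordinates_bij_iff[OF b]] by (rule conjunct1, rule conjunct2)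
    have **: "inj_on (\<lambda>i. P (b i)) {..<n}" "vs.independent ((\<lambda>i. P (b i)) ` {..<n})"
      using *(1) unfolding indep_family_iff[OF finite_lessThan] by simp_all
    have "vs.dim (P ` forms d) = card ((\<lambda>i. P (b i)) ` {..<n})"
      by (rule vs.dim_unique) (use b * ** in auto)
    then show "n = vs.dim (P ` forms d)" using **(1) by (simp add: card_image)
  qed
qed

lemma hilbert_fun_eq_0_iff: "hilbert_fun I d = 0 \<longleftrightarrow> forms d \<subseteq> I"
proof
  let ?v = "\<lambda>m. P (monomial m)"
  assume 0: "hilbert_fun I d = 0"
  obtain K where K: "K \<subseteq> monoms d" "finite K" "indep_family K ?v"
    "?v ` monoms d \<subseteq> vs.span (?v ` K)" "card K = vs.dim (?v ` monoms d)"
    by (rule indep_subfamily[OF finite_monoms])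
  then have "?v ` monoms d \<subseteq> {0}" using 0 by (simp add: hilbert_fun_eq_dim dim_forms)
  then have "P f = 0" if "f \<in> forms d" for f
    using P_form_span[OF that] vs.span_mono[of "?v ` monoms d" "{0}"] by auto
  then show "forms d \<subseteq> I" using kernel by blast
next
  assume "forms d \<subseteq> I"
  then have "P ` forms d \<subseteq> vs.span {}" using kernel by auto
  from vs.dim_le_card[OF this] show "hilbert_fun I d = 0" by (simp add: hilbert_fun_eq_dim)
qed

text \<open>
  Hence ideals with the same Hilbert function have the same top degree, and the strong Stanley property refers to the
  same reflection of degrees for both.
\<close>

lemma top_degree_eq: "top_degree I = Max {i. hilbert_fun I i \<noteq> 0}"
proof -
  have "quot_part I i = {cong_mod I `` {0}} \<longleftrightarrow> forms i \<subseteq> I" for i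
  proof -
    have *: "g ` A = {c} \<longleftrightarrow> (\<forall>x\<in>A. g x = c)" if "A \<noteq> {}" for g :: "'k poly3 \<Rightarrow> 'k poly3 set" and A c
      using that by auto
    have "forms i \<noteq> ({} :: 'k poly3 set)" using vs.subspace_0[OF subspace_forms] by blast
    from *[OF this] have "quot_part I i = {cong_mod I `` {0}} \<longleftrightarrow>
        (\<forall>f\<in>forms i. cong_mod I `` {f} = cong_mod I `` {0})"
      unfolding quot_part_def .
    then show ?thesis unfolding class_eq_iff P.zero kernel subset_eq .
  qed
  then show ?thesis unfolding top_degree_def by (simp add: hilbert_fun_eq_0_iff)
qed

lemma class_eq: "cong_mod I `` {f} = {x. P f = P x}"
  unfolding cong_mod_def P_eq_iff by blast

lemma quot_mult_class: "quot_mult I p (cong_mod I `` {f}) = cong_mod I `` {p * f}"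
proof -
  have mult: "P (p * f) = P (p * x)" if "P f = P x" for x
    using idl.subspace_scale[OF ideal that[unfolded P_eq_iff], of p]
    unfolding P_eq_iff by (simp only: right_diff_distrib)
  have "quot_mult I p (cong_mod I `` {f}) = (\<Union>x\<in>cong_mod I `` {f}. cong_mod I `` {p * x})"
    unfolding quot_mult_def by blast
  also have "\<dots> = cong_mod I `` {p * f}"
  proof (rule SUP_eq_const)
    show "cong_mod I `` {f} \<noteq> {}" unfolding class_eq by blast
    fix x assume "x \<in> cong_mod I `` {f}"
    then have "P f = P x" unfolding class_eq by (rule CollectD)
    then show "cong_mod I `` {p * x} = cong_mod I `` {p * f}"
      unfolding class_eq_iff by (rule mult[symmetric])
  qed
  finally show ?thesis .
qed

lemma quot_mult_bijD:
  assumes "bij_betw (quot_mult I p) (quot_part I i) (quot_part I j)"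
  shows "f \<in> forms i \<Longrightarrow> p * f \<in> I \<Longrightarrow> f \<in> I"
    and "g \<in> forms j \<Longrightarrow> \<exists>f\<in>forms i. P g = P (p * f)"
proof -
  assume f: "f \<in> forms i" "p * f \<in> I"
  have 0: "(0 :: 'k poly3) \<in> forms i" by (rule vs.subspace_0[OF subspace_forms])
  have "quot_mult I p (cong_mod I `` {f}) = quot_mult I p (cong_mod I `` {0})"
    using f(2) by (simp add: quot_mult_class class_eq_iff P.zero kernel)
  then have "cong_mod I `` {f} = cong_mod I `` {0}"
    using assms f(1) 0 unfolding bij_betw_def inj_on_def quot_part_def by blast
  then show "f \<in> I" by (simp add: class_eq_iff P.zero kernel)
next
  assume g: "g \<in> forms j"
  then have "cong_mod I `` {g} \<in> quot_mult I p ` quot_part I i"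
    using assms unfolding bij_betw_def quot_part_def by blast
  then show "\<exists>f\<in>forms i. P g = P (p * f)"
    by (auto simp: quot_part_def quot_mult_class class_eq_iff)
qed

lemma linear_mult: "Vector_Spaces.linear scal scal (\<lambda>f. P (p * f))"
  by unfold_locales (simp_all add: distrib_left scal_mult P.add P.scale)

lemma dim_mult_le_target:
  assumes "p \<in> forms j"
  shows "vs.dim ((\<lambda>f. P (p * f)) ` forms i) \<le> hilbert_fun I (i + j)"
  unfolding hilbert_fun_eq_dim dim_forms
proof (rule dim_mono_finite)
  show "(\<lambda>f. P (p * f)) ` forms i \<subseteq> vs.span ((\<lambda>m. P (monomial m)) ` monoms (i + j))"
    using forms_mult[OF assms] P_form_span by (force simp: add.commute)
qed simp

text \<open>
  Although \<open>P\<close> is not multiplicative, \<open>P (p * f)\<close> depends only on the class of \<open>f\<close>; hence representatives of a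
  basis of \<open>(R/I)\<^sub>i\<close> suffice to span the image.
\<close>

lemma dim_mult_le_source: "vs.dim ((\<lambda>f. P (p * f)) ` forms i) \<le> hilbert_fun I i"
proof -
  let ?v = "\<lambda>m. P (monomial m)"
  obtain K where K: "K \<subseteq> monoms i" "finite K" "indep_family K ?v"
    "?v ` monoms i \<subseteq> vs.span (?v ` K)" "card K = vs.dim (?v ` monoms i)"
    by (rule indep_subfamily[OF finite_monoms])
  have *: "P (p * monomial m) \<in> vs.span ((\<lambda>k. P (p * monomial k)) ` K)" if m: "m \<in> monoms i" for m
  proof -
    have "?v m \<in> vs.span (?v ` K)" using K(4) m by blast
    also have "vs.span (?v ` K) \<subseteq> {x. \<forall>f. x = P f \<longrightarrow> P (p * f) \<in> vs.span ((\<lambda>k. P (p * monomial k)) ` K)}"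
    proof
      fix x assume "x \<in> vs.span (?v ` K)"
      then have "\<exists>g. x = P g \<and> P (p * g) \<in> vs.span ((\<lambda>k. P (p * monomial k)) ` K)"
      proof (induct rule: vs.span_induct_alt)
        case base
        show ?case by (rule exI[of _ 0]) (simp add: P.zero vs.span_zero)
      next
        case (step c x y)
        then obtain k g where k: "k \<in> K" "x = ?v k" and
          g: "y = P g" "P (p * g) \<in> vs.span ((\<lambda>k. P (p * monomial k)) ` K)" by blast
        have "P (p * monomial k) \<in> vs.span ((\<lambda>k. P (p * monomial k)) ` K)"
          using k(1) by (intro vs.span_base) blast
        then show ?case using k g
          by (intro exI[of _ "scal c (monomial k) + g"])
            (simp add: P.add P.scale distrib_left scal_mult vs.span_add vs.span_scale)
      qed
      then obtain g where g: "x = P g" "P (p * g) \<in> vs.span ((\<lambda>k. P (p * monomial k)) ` K)" by blast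
      show "x \<in> {x. \<forall>f. x = P f \<longrightarrow> P (p * f) \<in> vs.span ((\<lambda>k. P (p * monomial k)) ` K)}"
      proof (intro CollectI allI impI)
        fix f assume "x = P f"
        then have "f - g \<in> I" using g(1) P_eq_iff by blast
        then have "p * f - p * g \<in> I" using idl.subspace_scale[OF ideal, of "f - g" p] by (simp add: right_diff_distrib)
        then show "P (p * f) \<in> vs.span ((\<lambda>k. P (p * monomial k)) ` K)" using g(2) P_eq_iff by metis
      qed
    qed
    finally show ?thesis by blast
  qed
  have "(\<lambda>f. P (p * f)) ` forms i \<subseteq> vs.span ((\<lambda>k. P (p * monomial k)) ` K)"
  proof safe
    fix f :: "'k poly3" assume f: "f \<in> forms i"
    show "P (p * f) \<in> vs.span ((\<lambda>k. P (p * monomial k)) ` K)"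
      by (subst forms_expand[OF f])
        (auto simp: sum_distrib_left scal_mult P.sum P.scale intro!: span_lincomb *)
  qed
  from vs.dim_le_card[OF this] have "vs.dim ((\<lambda>f. P (p * f)) ` forms i) \<le> card ((\<lambda>k. P (p * monomial k)) ` K)"
    using K(2) by simp
  also have "\<dots> \<le> card K" using K(2) by (rule card_image_le)
  finally show ?thesis by (simp add: hilbert_fun_eq_dim dim_forms K(5))
qed

end

section \<open>Linear substitutions\<close>

definition lform :: "'k::comm_ring_1 ^ 3 ^ 3 \<Rightarrow> 3 \<Rightarrow> 'k poly3"
  where "lform h j = (\<Sum>i\<in>UNIV. const (h $ i $ j) * var i)"

text \<open>
  The power product \<open>\<ell>\<^sup>m\<close> of the linear forms given by the columns of \<open>h\<close>.
\<close>

definition lmonom :: "'k::comm_ring_1 ^ 3 ^ 3 \<Rightarrow> monom3 \<Rightarrow> 'k poly3"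
  where "lmonom h = eval_mon (lform h)"

lemma lin_subst_alt: "lin_subst h = eval_poly const (lform h)"
  unfolding lin_subst_def lform_def ..

lemma lmonom_alt: "lmonom h m = lform h 1 ^ Poly_Mapping.lookup m 1 * lform h 2 ^ Poly_Mapping.lookup m 2 *
    lform h 3 ^ Poly_Mapping.lookup m 3"
proof -
  have "eval_mon (lform h) m = (\<Prod>v\<in>{1, 2, 3}. lform h v ^ Poly_Mapping.lookup m v)"
    unfolding UNIV_3[symmetric] by (rule eval_mon_superset) simp_all
  also have "\<dots> = lform h 1 ^ Poly_Mapping.lookup m 1 * (lform h 2 ^ Poly_Mapping.lookup m 2 *
    lform h 3 ^ Poly_Mapping.lookup m 3)"
    by (subst prod.insert; simp)+
  finally show ?thesis unfolding lmonom_def by (simp only: mult.assoc)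
qed

lemma lin_subst_monomial: "lin_subst h (monomial m) = lmonom h m"
  by (simp add: lin_subst_alt lmonom_def cst.eval_monomial)

lemma lin_subst_mult: "lin_subst h (f * g) = lin_subst h f * lin_subst h g"
  by (simp add: lin_subst_alt cst.eval_mult)

lemma lin_subst_add: "lin_subst h (f + g) = lin_subst h f + lin_subst h g"
  by (simp add: lin_subst_alt cst.eval_add)

lemma lin_subst_sum: "lin_subst h (\<Sum>i\<in>A. f i) = (\<Sum>i\<in>A. lin_subst h (f i))"
  by (simp add: lin_subst_alt cst.eval_sum)

lemma lin_subst_scal: "lin_subst h (scal c f) = scal c (lin_subst h f)"
  by (simp add: lin_subst_alt cst.eval_mult scal_def)

lemma lform_forms [simp]: "lform h j \<in> forms 1" for h :: "'k::field ^ 3 ^ 3"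
  unfolding lform_def scal_def[symmetric]
  by (rule vs.subspace_sum[OF subspace_forms], rule vs.subspace_scale[OF subspace_forms], rule var_forms)

lemma lmonom_forms: "lmonom h m \<in> forms (mdeg m)" for h :: "'k::field ^ 3 ^ 3"
  unfolding lmonom_alt mdeg_alt
  using forms_power[OF lform_forms, of h] by (intro forms_mult) (metis mult.right_neutral)+

lemma lin_subst_forms: "f \<in> forms d \<Longrightarrow> lin_subst h f \<in> forms d" for h :: "'k::field ^ 3 ^ 3"
  by (subst forms_expand[of f d], assumption, unfold lin_subst_sum lin_subst_scal lin_subst_monomial,
      rule vs.subspace_sum[OF subspace_forms], rule vs.subspace_scale[OF subspace_forms])
    (use lmonom_forms in \<open>auto simp: monoms_def\<close>)

lemma lin_subst_lform: "lin_subst g (lform h j) = lform (g ** h) j"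
proof -
  have "lin_subst g (lform h j) = (\<Sum>i\<in>UNIV. const (h $ i $ j) * lform g i)"
    unfolding lin_subst_alt by (simp add: lform_def[of h] cst.eval_sum cst.eval_mult)
  also have "\<dots> = (\<Sum>i\<in>UNIV. \<Sum>l\<in>UNIV. const (g $ l $ i * h $ i $ j) * var l)"
    by (simp add: lform_def sum_distrib_left mult.assoc mult.left_commute)
  also have "\<dots> = (\<Sum>l\<in>UNIV. \<Sum>i\<in>UNIV. const (g $ l $ i * h $ i $ j) * var l)"
    by (rule sum.swap)
  also have "\<dots> = lform (g ** h) j"
    unfolding lform_def sum_distrib_right[symmetric]
    by (simp add: matrix_matrix_mult_def const_def single_add sum_3)
  finally show ?thesis .
qed

lemma lin_subst_compose: "lin_subst g (lin_subst h f) = lin_subst (g ** h) f"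
proof -
  have "lin_subst g (eval_mon (lform h) m) = eval_mon (lform (g ** h)) m" for m
    unfolding eval_mon_def
    by (simp add: lin_subst_alt cst.eval_prod cst.eval_power lin_subst_lform[unfolded lin_subst_alt])
  then show ?thesis
    unfolding lin_subst_alt[of h] lin_subst_alt[of "g ** h"] eval_poly_def eval_mon_def[symmetric]
    by (simp add: lin_subst_sum lin_subst_mult) (simp add: lin_subst_alt)
qed

lemma monomial_add: "monomial (m + n) = monomial m * (monomial n :: _ \<Rightarrow>\<^sub>0 'k::comm_ring_1)"
  by (simp add: monomial_def mult_single)

lemma monomial_power_var: "monomial (Poly_Mapping.single i a) = (var i ^ a :: _ \<Rightarrow>\<^sub>0 'k::comm_ring_1)"
proof (induct a)
  case 0
  show ?case by (simp add: monomial_def)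
next
  case (Suc a)
  have "Poly_Mapping.single i (Suc a) = Poly_Mapping.single i 1 + Poly_Mapping.single i a"
    by (simp add: single_add[symmetric])
  then show ?case using Suc by (simp add: monomial_add monomial_def[of "Poly_Mapping.single i (Suc 0)"] var_def)
qed

lemma mon_lookup: "mon (Poly_Mapping.lookup m 1) (Poly_Mapping.lookup m 2) (Poly_Mapping.lookup m 3) = m"
  by (rule monom3_eqI) simp_all

lemma lin_subst_id: "lin_subst (mat 1) f = f" for f :: "'k::comm_ring_1 poly3"
proof -
  have "lform (mat 1) j = (var j :: 'k poly3)" for j :: 3
  proof -
    have "lform (mat 1) j = (\<Sum>i\<in>UNIV. if i = j then var i else (0 :: 'k poly3))"
      unfolding lform_def by (intro sum.cong) (auto simp: mat_def)
    then show ?thesis by simp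
  qed
  then have "lmonom (mat 1) m = (monomial m :: 'k poly3)" for m
    unfolding lmonom_alt by (subst (4) mon_lookup[symmetric])
      (simp add: mon_def monomial_add monomial_power_var)
  then show ?thesis
    by (subst (1 2) poly_eq_sum_monomials[of "Poly_Mapping.keys f" f])
      (simp_all add: lin_subst_sum lin_subst_scal lin_subst_monomial)
qed

lemma lin_subst_inverse:
  "g ** h = mat 1 \<Longrightarrow> lin_subst g (lin_subst h f) = f"
  by (simp add: lin_subst_compose lin_subst_id)

text \<open>
  Linear substitutions preserve degrees, hence commute with taking homogeneous components.
\<close>

lemma hcomp_lin_subst: "hcomp d (lin_subst h f) = lin_subst h (hcomp d f)" for h :: "'k::field ^ 3 ^ 3"
proof -
  have f: "f = (\<Sum>m\<in>Poly_Mapping.keys f. scal (Poly_Mapping.lookup f m) (monomial m))"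
    by (rule poly_eq_sum_monomials) simp_all
  have 0: "lin_subst h 0 = 0" by (simp add: lin_subst_alt)
  show ?thesis
    by (subst (1 2) f)
      (auto simp: lin_subst_sum lin_subst_scal lin_subst_monomial hcomp_sum hcomp_scal 0
        hcomp_of_form[OF lmonom_forms] hcomp_of_form[OF monomial_forms] intro!: sum.cong)
qed

lemma lin_subst_image_forms:
  fixes h :: "'k::field ^ 3 ^ 3"
  assumes "invertible h"
  shows "lin_subst h ` forms d = forms d"
proof (intro equalityI subsetI)
  fix f :: "'k poly3" assume f: "f \<in> forms d"
  have "f = lin_subst h (lin_subst (matrix_inv h) f)"
    using lin_subst_inverse[OF matrix_inv_both(1)[OF assms]] by simp
  then show "f \<in> lin_subst h ` forms d" using lin_subst_forms[OF f] by blast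
qed (auto simp: lin_subst_forms)

lemma lmonom_add_x3: "lmonom h (n + Poly_Mapping.single 3 c) = lform h 3 ^ c * lmonom h n"
  by (simp add: lmonom_alt lookup_add lookup_single power_add mult_ac)

lemma linear_lin_subst: "Vector_Spaces.linear scal scal (lin_subst h)" for h :: "'k::field ^ 3 ^ 3"
  by unfold_locales (simp_all add: lin_subst_add lin_subst_scal)

lemma lform_fam: "(\<lambda>h. lform h j) \<in> poly_fams mat_coords"
  unfolding lform_def scal_def[symmetric]
  by (rule poly_fams_sum, rule poly_fams.scale[OF poly_funs.coord poly_fams.const]) blast

lemma lmonom_fam: "(\<lambda>h. lmonom h m) \<in> poly_fams mat_coords"
  unfolding lmonom_alt by (intro poly_fams_mult poly_fams_power lform_fam)

section \<open>First-order deformation\<close>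

text \<open>
  Replacing one factor \<open>x\<^sub>2\<close> by \<open>x\<^sub>1\<close>.  If \<open>x\<^sub>2\<close> does not occur, truncated subtraction gives a junk value, which
  is always multiplied by the exponent \<open>0\<close> below.
\<close>

definition shift :: "monom3 \<Rightarrow> monom3"
  where "shift n = mon (Suc (Poly_Mapping.lookup n 1)) (Poly_Mapping.lookup n 2 - 1) (Poly_Mapping.lookup n 3)"

text \<open>
  The deformation \<open>\<ell>\<^sub>2 \<mapsto> \<ell>\<^sub>2 + s\<ell>\<^sub>1\<close> of the linear forms.
\<close>

definition shear :: "'k::comm_ring_1 ^ 3 ^ 3 \<Rightarrow> 'k \<Rightarrow> 'k ^ 3 ^ 3"
  where "shear h s = (\<chi> i j. if j = 2 then h $ i $ 2 + s * h $ i $ 1 else h $ i $ j)"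

lemma lform_shear:
  "lform (shear h s) 1 = lform h 1" "lform (shear h s) 3 = lform h 3"
  "lform (shear h s) 2 = lform h 2 + scal s (lform h 1)"
proof -
  have "shear h s $ i $ j = h $ i $ j" if "j \<noteq> 2" for i j
    using that by (simp add: shear_def)
  from this[of 1] this[of 3] show "lform (shear h s) 1 = lform h 1" "lform (shear h s) 3 = lform h 3"
    unfolding lform_def by simp_all
  have 2: "shear h s $ i $ 2 = h $ i $ 2 + s * h $ i $ 1" for i by (simp add: shear_def)
  have "const (shear h s $ i $ 2) * var i = const (h $ i $ 2) * var i + const s * (const (h $ i $ 1) * var i)" for i
    unfolding 2 const_hom by (simp only: distrib_right mult.assoc)
  then show "lform (shear h s) 2 = lform h 2 + scal s (lform h 1)"
    unfolding lform_def scal_def by (simp only: sum.distrib sum_distrib_left)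
qed

text \<open>
  The exact remainder \<open>W\<close> is kept, and not only its value at \<open>0\<close>: the vectors that it yields have to be considered at
  some \<open>s \<noteq> 0\<close>.
\<close>

lemma power_first_order:
  fixes X Y :: "('v \<Rightarrow>\<^sub>0 nat) \<Rightarrow>\<^sub>0 'k::field"
  shows "\<exists>W\<in>poly_fams {\<lambda>s. s}. (\<forall>s. (X + scal s Y) ^ k = X ^ k + scal s (W s)) \<and>
    W 0 = scal (of_nat k) (X ^ (k - 1) * Y)"
proof (induct k)
  case 0
  show ?case by (rule bexI[of _ "\<lambda>_. 0"]) (simp_all add: poly_fams.const)
next
  case (Suc k)
  then obtain W where W: "W \<in> poly_fams {\<lambda>s. s}" "\<And>s. (X + scal s Y) ^ k = X ^ k + scal s (W s)"
    "W 0 = scal (of_nat k) (X ^ (k - 1) * Y)" by blast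
  have lin: "(\<lambda>s. X + scal s Y) \<in> poly_fams {\<lambda>s. s}"
    by (intro poly_fams.add poly_fams.const poly_fams.scale poly_funs.coord) simp
  show ?case
  proof (intro bexI conjI allI)
    show "(\<lambda>s. X ^ k * Y + (X + scal s Y) * W s) \<in> poly_fams {\<lambda>s. s}"
      by (intro poly_fams.add poly_fams.const poly_fams_mult lin W)
    show "(X + scal s Y) ^ Suc k = X ^ Suc k + scal s (X ^ k * Y + (X + scal s Y) * W s)" for s
      by (simp add: W(2) distrib_left distrib_right scal_mult vs.scale_right_distrib mult.commute)
    have "X * W 0 = scal (of_nat k) (X ^ k * Y)"
      by (cases k) (simp_all add: W(3) scal_mult mult.assoc)
    then show "X ^ k * Y + (X + scal 0 Y) * W 0 = scal (of_nat (Suc k)) (X ^ (Suc k - 1) * Y)"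
      by (simp add: vs.scale_left_distrib)
  qed
qed

lemma lmonom_shear:
  fixes h :: "'k::field ^ 3 ^ 3"
  shows "\<exists>W\<in>poly_fams {\<lambda>s. s}. (\<forall>s. lmonom (shear h s) n = lmonom h n + scal s (W s)) \<and>
    W 0 = scal (of_nat (Poly_Mapping.lookup n 2)) (lmonom h (shift n))"
proof -
  let ?a = "lform h 1 ^ Poly_Mapping.lookup n 1" and ?c = "lform h 3 ^ Poly_Mapping.lookup n 3"
  obtain W where W: "W \<in> poly_fams {\<lambda>s. s}"
    "\<And>s. (lform h 2 + scal s (lform h 1)) ^ Poly_Mapping.lookup n 2 = lform h 2 ^ Poly_Mapping.lookup n 2 + scal s (W s)"
    "W 0 = scal (of_nat (Poly_Mapping.lookup n 2)) (lform h 2 ^ (Poly_Mapping.lookup n 2 - 1) * lform h 1)"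
    using power_first_order[of "lform h 2" "lform h 1" "Poly_Mapping.lookup n 2"] by blast
  show ?thesis
  proof (intro bexI conjI allI)
    show "(\<lambda>s. ?a * ?c * W s) \<in> poly_fams {\<lambda>s. s}"
      by (intro poly_fams_mult poly_fams.const W)
    show "lmonom (shear h s) n = lmonom h n + scal s (?a * ?c * W s)" for s
      by (simp add: lmonom_alt lform_shear W(2) distrib_left distrib_right scal_mult mult_ac)
    show "?a * ?c * W 0 = scal (of_nat (Poly_Mapping.lookup n 2)) (lmonom h (shift n))"
      by (simp add: lmonom_alt shift_def W(3) scal_mult mult_ac)
  qed
qed

lemma shear_0: "shear h 0 = h"
  by (auto simp: shear_def vec_eq_iff)

text \<open>
  Provides the point of the matrix space at which the semicontinuity argument for the ranks of powers of \<open>L\<close> starts;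
  invertibility is imposed separately, as a further generic condition.
\<close>

lemma linear_form_eq_lform:
  fixes L :: "'k::field poly3"
  assumes "L \<in> forms 1"
  shows "\<exists>h. lform h 3 = L"
proof
  define h :: "'k ^ 3 ^ 3" where "h = (\<chi> i j. Poly_Mapping.lookup L (Poly_Mapping.single i 1))"
  have monoms: "monoms 1 = (\<lambda>i. Poly_Mapping.single i 1) ` UNIV"
  proof (intro equalityI subsetI)
    fix m assume "m \<in> monoms 1"
    then have deg: "Poly_Mapping.lookup m 1 + Poly_Mapping.lookup m 2 + Poly_Mapping.lookup m 3 = 1"
      unfolding monoms_def mem_Collect_eq mdeg_alt .
    consider "Poly_Mapping.lookup m 1 = 1" "Poly_Mapping.lookup m 2 = 0" "Poly_Mapping.lookup m 3 = 0"
      | "Poly_Mapping.lookup m 1 = 0" "Poly_Mapping.lookup m 2 = 1" "Poly_Mapping.lookup m 3 = 0"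
      | "Poly_Mapping.lookup m 1 = 0" "Poly_Mapping.lookup m 2 = 0" "Poly_Mapping.lookup m 3 = 1"
      using deg by linarith
    then have "\<exists>i. mon (Poly_Mapping.lookup m 1) (Poly_Mapping.lookup m 2) (Poly_Mapping.lookup m 3) =
        Poly_Mapping.single i 1"
      by cases (auto simp only: mon_def single_zero add_0_left add_0_right)
    then have "\<exists>i. m = Poly_Mapping.single i 1" unfolding mon_lookup .
    then show "m \<in> (\<lambda>i. Poly_Mapping.single i 1) ` UNIV" by blast
  next
    fix m :: monom3 assume "m \<in> (\<lambda>i. Poly_Mapping.single i 1) ` UNIV"
    then show "m \<in> monoms 1" by (auto simp: monoms_def mdeg_def lookup_single when_def)
  qed
  have inj: "inj (\<lambda>i :: 3. Poly_Mapping.single i (1::nat))"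
    by (rule injI) (metis lookup_single_eq lookup_single_not_eq zero_neq_one)
  have "L = (\<Sum>m\<in>monoms 1. scal (Poly_Mapping.lookup L m) (monomial m))"
    by (rule forms_expand[OF assms])
  also have "\<dots> = lform h 3"
    unfolding monoms sum.reindex[OF inj] by (simp add: lform_def h_def scal_def monomial_def var_def)
  finally show "lform h 3 = L" ..
qed

section \<open>Generic ranks\<close>

text \<open>
  The expected rank of multiplication by the \<open>j\<close>-th power of a Lefschetz element from degree \<open>i\<close> to degree \<open>i + j\<close>.
  For a Hilbert function \<open>H\<close> with the strong Stanley property and top degree \<open>t\<close> it is the smaller of \<open>H i\<close> and
  \<open>H (i + j)\<close>; the case distinction tells which one, by comparing \<open>i + j\<close> with the reflection \<open>t - i\<close> of \<open>i\<close>.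
\<close>

definition lefschetz_rank :: "(nat \<Rightarrow> nat) \<Rightarrow> nat \<Rightarrow> nat \<Rightarrow> nat \<Rightarrow> nat"
  where "lefschetz_rank H t i j = (if 2 * i + j \<le> t then H i else H (i + j))"

context homogeneous_quotient
begin

lemma dim_mult_forms: "vs.dim ((\<lambda>f. P (p * f)) ` forms i) = vs.dim ((\<lambda>m. P (p * monomial m)) ` monoms i)"
  by (rule dim_image_forms[OF linear_mult])

text \<open>
  If \<open>i + j \<le> t - i\<close>, the bijection from degree \<open>i\<close> to degree \<open>t - i\<close> factors through multiplication by
  \<open>L\<^sup>j\<close> from degree \<open>i\<close>, which is therefore injective.  Otherwise, if \<open>i + j \<le> t\<close>, the bijection ending in degree \<open>i + j\<close> starts in
  degree \<open>t - (i + j) < i\<close>, so it factors through the same map on the other side, and that map is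
  surjective; if \<open>i + j > t\<close>, the target is zero.
\<close>

lemma strong_stanley_rank:
  assumes "strong_stanley I" "finite {i. hilbert_fun I i \<noteq> 0}"
  shows "\<exists>L\<in>forms 1. \<forall>i j. lefschetz_rank (hilbert_fun I) (top_degree I) i j \<le> vs.dim ((\<lambda>f. P (L ^ j * f)) ` forms i)"
proof -
  define t where "t = top_degree I"
  obtain L where L: "L \<in> forms 1" and bij: "\<And>i. i \<le> t div 2 \<Longrightarrow>
      bij_betw (quot_mult I (L ^ (t - 2 * i))) (quot_part I i) (quot_part I (t - i))"
    using assms(1) unfolding strong_stanley_def Let_def t_def by blast
  have above: "hilbert_fun I i = 0" if "i > t" for i
  proof (rule ccontr)
    assume "hilbert_fun I i \<noteq> 0"
    then have "i \<le> t" unfolding t_def top_degree_eq using assms(2) by (intro Max_ge) auto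
    then show False using that by simp
  qed
  have "lefschetz_rank (hilbert_fun I) t i j \<le> vs.dim ((\<lambda>f. P (L ^ j * f)) ` forms i)" for i j
  proof (cases "2 * i + j \<le> t")
    case True
    let ?v = "\<lambda>m. P (monomial m)" and ?w = "\<lambda>m. P (L ^ j * monomial m)"
    obtain K where K: "K \<subseteq> monoms i" "finite K" "indep_family K ?v"
      "?v ` monoms i \<subseteq> vs.span (?v ` K)" "card K = vs.dim (?v ` monoms i)"
      by (rule indep_subfamily[OF finite_monoms])
    have "indep_family K ?w"
      unfolding indep_family_def
    proof (intro allI impI ballI)
      fix c k assume c: "(\<Sum>k\<in>K. scal (c k) (?w k)) = 0" and k: "k \<in> K"
      define F where "F = (\<Sum>k\<in>K. scal (c k) (monomial k))"
      have F: "F \<in> forms i"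
        unfolding F_def using K(1) monomial_monoms
        by (intro vs.subspace_sum[OF subspace_forms] vs.subspace_scale[OF subspace_forms]) blast
      have "P (L ^ j * F) = 0"
        using c by (simp add: F_def sum_distrib_left scal_mult P.sum P.scale)
      then have "L ^ (t - 2 * i - j) * (L ^ j * F) \<in> I"
        using idl.subspace_scale[OF ideal] kernel by blast
      moreover have "L ^ (t - 2 * i - j) * (L ^ j * F) = L ^ (t - 2 * i) * F"
      proof -
        have e: "t - 2 * i = (t - 2 * i - j) + j" using True by simp
        show ?thesis by (subst (2) e) (simp only: power_add mult.assoc)
      qed
      ultimately have LF: "L ^ (t - 2 * i) * F \<in> I" by (simp only:)
      have "F \<in> I" by (rule quot_mult_bijD(1)[OF bij F LF]) (use True in simp)
      then have "(\<Sum>k\<in>K. scal (c k) (?v k)) = 0"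
        unfolding kernel[symmetric] F_def by (simp add: P.sum P.scale)
      then show "c k = 0" using indep_familyD[OF K(3)] k by blast
    qed
    then have "card K \<le> vs.dim (?w ` monoms i)"
      using K(1,2) by (intro indep_family_card_le) (auto intro: vs.span_base)
    then show ?thesis
      using True by (simp add: lefschetz_rank_def hilbert_fun_eq_dim dim_forms K(5) dim_mult_forms)
  next
    case False
    show ?thesis
    proof (cases "i + j > t")
      case True
      then show ?thesis using False above by (simp add: lefschetz_rank_def)
    next
      case le: False
      define i' where "i' = t - (i + j)"
      have i': "i' \<le> t div 2" "t - i' = i + j" "t - 2 * i' = (i - i') + j" "i' \<le> i"
        using le False unfolding i'_def by linarith+
      have "P ` forms (i + j) \<subseteq> (\<lambda>f. P (L ^ j * f)) ` forms i"
      proof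
        fix x assume "x \<in> P ` forms (i + j)"
        then obtain g where g: "g \<in> forms (t - i')" "x = P g" unfolding i' by blast
        obtain f where f: "f \<in> forms i'" "P g = P (L ^ (t - 2 * i') * f)"
          using quot_mult_bijD(2)[OF bij[OF i'(1)] g(1)] by blast
        have "L ^ (i - i') * f \<in> forms i"
          using forms_mult[OF forms_power[OF L] f(1), of "i - i'"] i'(4) by simp
        moreover have "x = P (L ^ j * (L ^ (i - i') * f))"
          unfolding g(2) f(2) i'(3) by (simp add: power_add mult_ac)
        ultimately show "x \<in> (\<lambda>f. P (L ^ j * f)) ` forms i" by blast
      qed
      also have "\<dots> \<subseteq> vs.span ((\<lambda>m. P (L ^ j * monomial m)) ` monoms i)"
      proof -
        interpret Q: Vector_Spaces.linear scal scal "\<lambda>f. P (L ^ j * f)" by (rule linear_mult)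
        show ?thesis
          unfolding forms_eq_span Q.span_image[symmetric] image_image by simp
      qed
      finally have "vs.dim (P ` forms (i + j)) \<le> vs.dim ((\<lambda>m. P (L ^ j * monomial m)) ` monoms i)"
        by (rule dim_mono_finite) simp
      then show ?thesis using False by (simp add: lefschetz_rank_def hilbert_fun_eq_dim dim_mult_forms)
    qed
  qed
  then show ?thesis using L unfolding t_def by blast
qed

text \<open>
  One linear form with a large rank gives large ranks generically, by semicontinuity.
\<close>

lemma lefschetz_generic:
  assumes "L \<in> forms 1" "r \<le> vs.dim ((\<lambda>f. P (L ^ j * f)) ` forms i)"
  shows "generic (\<lambda>h. r \<le> vs.dim ((\<lambda>f. P (lform h 3 ^ j * f)) ` forms i))"
proof -
  obtain h0 where h0: "lform h0 3 = L" using linear_form_eq_lform[OF assms(1)] by blast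
  let ?w = "\<lambda>m h. P (lform h 3 ^ j * monomial m)"
  obtain K where K: "K \<subseteq> monoms i" "finite K" "indep_family K (\<lambda>m. ?w m h0)"
    "card K = vs.dim ((\<lambda>m. ?w m h0) ` monoms i)"
    using indep_subfamily[OF finite_monoms, of i "\<lambda>m. ?w m h0"] by metis
  have fam: "(\<lambda>h. Poly_Mapping.lookup (?w m h) n) \<in> poly_funs mat_coords" for m n
    by (intro poly_fams_lookup poly_fams_linear[OF _ linear_P] poly_fams_mult poly_fams_power
        lform_fam poly_fams.const)
  from indep_family_open[OF K(2) fam K(3)] obtain q where q: "q \<in> mat_funs" "q h0 \<noteq> 0"
    "\<And>h. q h \<noteq> 0 \<Longrightarrow> indep_family K (\<lambda>m. ?w m h)" unfolding mat_funs_def by blast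
  have *: "r \<le> vs.dim ((\<lambda>f. P (lform h 3 ^ j * f)) ` forms i)" if "q h \<noteq> 0" for h
  proof -
    have "r \<le> card K" using assms(2) by (simp add: K(4) h0 dim_mult_forms)
    also have "card K \<le> vs.dim ((\<lambda>m. ?w m h) ` monoms i)"
      using K(1) by (intro indep_family_card_le[OF K(2) q(3)[OF that]]) (auto intro: vs.span_base)
    finally show ?thesis by (simp add: dim_mult_forms)
  qed
  show ?thesis by (rule genericI[OF q(1,2)]) (rule *)
qed

text \<open>
  Choose an independent subfamily at a matrix where the rank is largest; it stays independent on an open set.  The
  maximum is taken over all matrices, so that \<open>dependence_propagates\<close> can compare with any deformation of \<open>h\<close>.
\<close>

lemma max_rank_generic:
  assumes "finite D"
  shows "generic (\<lambda>h. \<forall>h'. vs.dim ((\<lambda>n. P (lmonom h' n)) ` D) \<le> vs.dim ((\<lambda>n. P (lmonom h n)) ` D))"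
proof -
  let ?r = "\<lambda>h. vs.dim ((\<lambda>n. P (lmonom h n)) ` D)"
  have "?r h \<le> card D" for h
  proof -
    have "?r h \<le> card ((\<lambda>n. P (lmonom h n)) ` D)" using assms by (intro vs.dim_le_card vs.span_superset) simp
    also have "\<dots> \<le> card D" using assms by (rule card_image_le)
    finally show ?thesis .
  qed
  then have "\<exists>h0. \<forall>h. ?r h \<le> ?r h0"
    using ex_has_greatest_nat[of "\<lambda>_. True" undefined ?r "Suc (card D)"] by (auto simp: less_Suc_eq_le)
  then obtain h0 where h0: "\<And>h. ?r h \<le> ?r h0" by blast
  obtain K where K: "K \<subseteq> D" "finite K" "indep_family K (\<lambda>n. P (lmonom h0 n))" "card K = ?r h0"
    using indep_subfamily[OF assms, of "\<lambda>n. P (lmonom h0 n)"] by metis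
  have fam: "(\<lambda>h. Poly_Mapping.lookup (P (lmonom h m)) n) \<in> poly_funs mat_coords" for m n
    by (intro poly_fams_lookup poly_fams_linear[OF _ linear_P] lmonom_fam)
  from indep_family_open[OF K(2) fam K(3)] obtain q where q: "q \<in> mat_funs" "q h0 \<noteq> 0"
    "\<And>h. q h \<noteq> 0 \<Longrightarrow> indep_family K (\<lambda>m. P (lmonom h m))" unfolding mat_funs_def by blast
  have *: "?r h' \<le> ?r h" if "q h \<noteq> 0" for h h'
  proof -
    have "?r h' \<le> card K" using h0 by (simp add: K(4))
    also have "card K \<le> ?r h"
      using K(1) assms by (intro indep_family_card_le[OF K(2) q(3)[OF that]]) (auto intro: vs.span_base)
    finally show ?thesis .
  qed
  show ?thesis by (rule genericI[OF q(1,2)]) (intro allI *)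
qed

text \<open>
  Let \<open>v n(s)\<close> be the vectors deformed along \<open>\<ell>\<^sub>2 \<mapsto> \<ell>\<^sub>2 + s\<ell>\<^sub>1\<close>, and let \<open>v t = \<Sum> c n \<cdot> v n\<close> over a basis
  indexed by \<open>K\<close>.  Then \<open>v t(s) - \<Sum> c n \<cdot> v n(s)\<close> vanishes at \<open>s = 0\<close>, so it equals \<open>s \<cdot> y(s)\<close>, and \<open>y(0)\<close> is
  \<open>t\<^sub>2 \<cdot> v (shift t)\<close> plus vectors that lie in the span by the closure condition.  In characteristic \<open>0\<close> the
  factor \<open>t\<^sub>2\<close> is invertible.  If \<open>v (shift t)\<close> were not in the span, the basis together with \<open>y(s)\<close> would
  be independent for some \<open>s \<noteq> 0\<close>, and the deformed family would have larger rank.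
\<close>

lemma dependence_propagates:
  assumes D: "finite D" "t \<notin> D" and t: "Poly_Mapping.lookup t 2 > 0"
    and closed: "\<And>n. n \<in> D \<Longrightarrow> Poly_Mapping.lookup n 2 > 0 \<Longrightarrow> shift n \<in> insert t D"
    and max: "\<And>h'. vs.dim ((\<lambda>n. P (lmonom h' n)) ` insert t D) \<le> vs.dim ((\<lambda>n. P (lmonom h n)) ` insert t D)"
    and dep: "P (lmonom h t) \<in> vs.span ((\<lambda>n. P (lmonom h n)) ` D)"
  shows "P (lmonom h (shift t)) \<in> vs.span ((\<lambda>n. P (lmonom h n)) ` insert t D)"
proof (rule ccontr)
  let ?v = "\<lambda>n. P (lmonom h n)"
  let ?S = "vs.span (?v ` insert t D)"
  assume not: "?v (shift t) \<notin> ?S"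
  obtain K where K: "K \<subseteq> D" "finite K" "indep_family K ?v" "?v ` D \<subseteq> vs.span (?v ` K)"
    "card K = vs.dim (?v ` D)"
    by (rule indep_subfamily[OF D(1)])
  have SD: "?S = vs.span (?v ` D)" using vs.span_redundant[OF dep] by simp
  have SK: "vs.span (?v ` D) = vs.span (?v ` K)"
    by (rule antisym) (use K(1,4) vs.span_mono[OF K(4)] in \<open>auto simp: vs.span_span intro!: vs.span_mono\<close>)
  obtain c where c: "?v t = (\<Sum>n\<in>K. scal (c n) (?v n))"
    using span_image_lincomb[OF _ K(2), of "?v t" ?v] dep SK by auto
  have "\<forall>n. \<exists>W. W \<in> poly_fams {\<lambda>s. s} \<and> (\<forall>s. lmonom (shear h s) n = lmonom h n + scal s (W s)) \<and>
      W 0 = scal (of_nat (Poly_Mapping.lookup n 2)) (lmonom h (shift n))"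
    using lmonom_shear[of h] by blast
  from choice[OF this] obtain W where W: "\<And>n. W n \<in> poly_fams {\<lambda>s. s}"
    "\<And>n s. lmonom (shear h s) n = lmonom h n + scal s (W n s)"
    "\<And>n. W n 0 = scal (of_nat (Poly_Mapping.lookup n 2)) (lmonom h (shift n))" by blast
  define y where "y s = P (W t s) - (\<Sum>n\<in>K. scal (c n) (P (W n s)))" for s
  define u where "u n s = (if n = t then y s else P (lmonom (shear h s) n))" for n s
  have tK: "t \<notin> K" using D(2) K(1) by blast
  have fam: "(\<lambda>s. Poly_Mapping.lookup (u n s) m) \<in> poly_funs {\<lambda>s. s}" for n m
  proof (cases "n = t")
    case True
    have "(\<lambda>s. P (W t s) - (\<Sum>n\<in>K. scal (c n) (P (W n s)))) \<in> poly_fams {\<lambda>s. s}"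
      by (intro poly_fams_diff poly_fams_sum poly_fams.scale poly_funs.const poly_fams_linear[OF W(1) linear_P])
    from poly_fams_lookup[OF this] show ?thesis using True by (simp add: u_def y_def)
  next
    case False
    have "(\<lambda>s. lmonom h n + scal s (W n s)) \<in> poly_fams {\<lambda>s. s}"
      by (intro poly_fams.add poly_fams.const poly_fams.scale W(1) poly_funs.coord) simp
    from poly_fams_lookup[OF poly_fams_linear[OF this linear_P]] show ?thesis
      using False by (simp add: u_def W(2))
  qed
  have u0: "u n 0 = ?v n" if "n \<noteq> t" for n using that by (simp add: u_def shear_0)
  \<comment> \<open>by the first-order terms, \<open>y 0\<close> is a nonzero multiple of \<open>?v (shift t)\<close> modulo \<open>?S\<close>\<close>
  have "y 0 \<notin> ?S"
  proof
    assume y: "y 0 \<in> ?S"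
    have "scal (c n) (P (W n 0)) \<in> ?S" if "n \<in> K" for n
    proof (cases "Poly_Mapping.lookup n 2 > 0")
      case True
      then have "?v (shift n) \<in> ?S" using closed K(1) that by (intro vs.span_base) blast
      then show ?thesis by (simp add: W(3) P.scale vs.span_scale)
    qed (simp add: W(3) P.zero vs.span_zero)
    then have "y 0 + (\<Sum>n\<in>K. scal (c n) (P (W n 0))) \<in> ?S"
      using y by (intro vs.span_add vs.span_sum)
    then have "scal (of_nat (Poly_Mapping.lookup t 2)) (?v (shift t)) \<in> ?S"
      by (simp add: y_def W(3) P.scale)
    then have "scal (1 / of_nat (Poly_Mapping.lookup t 2)) (scal (of_nat (Poly_Mapping.lookup t 2)) (?v (shift t))) \<in> ?S"
      by (rule vs.span_scale)
    then show False using not t by simp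
  qed
  moreover have im0: "(\<lambda>n. u n 0) ` K = ?v ` K" using tK by (intro image_cong refl u0) blast
  moreover have "indep_family K (\<lambda>n. u n 0)"
    using K(3) tK u0 unfolding indep_family_def by (metis (mono_tags, lifting) sum.cong)
  ultimately have "indep_family (insert t K) (\<lambda>n. u n 0)"
    using K(2) SD SK by (intro indep_family_insert) (auto simp: u_def)
  from indep_family_open[OF _ fam this] K(2) obtain q where q: "q \<in> line_funs" "q 0 \<noteq> 0"
    "\<And>s. q s \<noteq> 0 \<Longrightarrow> indep_family (insert t K) (\<lambda>n. u n s)" unfolding line_funs_def by auto
  \<comment> \<open>dividing by \<open>s\<close> brings \<open>y s\<close> back into the span of the deformed family\<close>
  obtain s where s: "s \<noteq> 0" "q s \<noteq> 0" using line_funs_other_nonzero[OF q(1,2)] by blast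
  let ?T = "(\<lambda>n. P (lmonom (shear h s) n)) ` insert t D"
  have base: "P (lmonom (shear h s) n) \<in> vs.span ?T" if "n \<in> insert t D" for n
    using that by (intro vs.span_base) blast
  have "(\<Sum>n\<in>K. scal (c n) (P (lmonom (shear h s) n))) \<in> vs.span ?T"
    using K(1) by (intro span_lincomb base) blast
  then have z: "P (lmonom (shear h s) t) - (\<Sum>n\<in>K. scal (c n) (P (lmonom (shear h s) n))) \<in> vs.span ?T"
    by (intro vs.span_diff base) auto
  have "P (lmonom (shear h s) t) - (\<Sum>n\<in>K. scal (c n) (P (lmonom (shear h s) n))) = scal s (y s)"
    by (simp add: W(2) P.add P.scale c y_def vs.scale_right_distrib vs.scale_right_diff_distrib sum.distrib
        vs.scale_sum_right vs.scale_left_commute algebra_simps)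
  with z have "scal (1 / s) (scal s (y s)) \<in> vs.span ?T" by (metis vs.span_scale)
  then have ys: "y s \<in> vs.span ?T" using s(1) by simp
  have "u n s \<in> vs.span ?T" if "n \<in> insert t K" for n
    using that ys base[of n] K(1) by (auto simp: u_def)
  then have "card (insert t K) \<le> vs.dim ?T"
    using K(2) D(1) by (intro indep_family_card_le[OF _ q(3)[OF s(2)]]) auto
  also have "\<dots> \<le> vs.dim (?v ` insert t D)" by (rule max)
  also have "\<dots> = card K" using SD K(5) by (metis vs.dim_span)
  finally show False using K(2) tK by simp
qed

end

section \<open>Initial segments of the order\<close>

text \<open>
  The monomials of degree \<open>d\<close> that are at most \<open>x\<^sub>1\<^sup>a x\<^sub>2\<^sup>b x\<^sub>3\<^sup>c\<close>, where \<open>a = d - b - c\<close>.  For \<open>b = 0\<close> these are the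
  multiples of \<open>x\<^sub>3\<^sup>c\<close>, and for \<open>b = d - c + 1\<close>, one step past the last monomial, the multiples of \<open>x\<^sub>3\<^sup>c\<^sup>+\<^sup>1\<close>.
\<close>

definition lower :: "nat \<Rightarrow> nat \<Rightarrow> nat \<Rightarrow> monom3 set"
  where "lower d c b = {n \<in> monoms d. Poly_Mapping.lookup n 3 > c \<or>
    Poly_Mapping.lookup n 3 = c \<and> Poly_Mapping.lookup n 2 \<ge> b}"

lemma finite_lower [simp]: "finite (lower d c b)"
  by (rule finite_subset[of _ "monoms d"]) (auto simp: lower_def)

lemma lower_step:
  assumes "c \<le> d" "b \<le> d - c"
  shows "lower d c b = insert (mon (d - c - b) b c) (lower d c (Suc b))"
proof (intro equalityI subsetI)
  fix n assume n: "n \<in> lower d c b"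
  show "n \<in> insert (mon (d - c - b) b c) (lower d c (Suc b))"
  proof (cases "n \<in> lower d c (Suc b)")
    case False
    then have "n = mon (d - c - b) b c"
      using n by (intro monom3_eqI) (auto simp: lower_def monoms_def mdeg_alt)
    then show ?thesis by simp
  qed simp
qed (use assms in \<open>auto simp: lower_def monoms_def\<close>)

lemma lower_last: "c \<le> d \<Longrightarrow> lower d c (Suc (d - c)) = lower d (Suc c) 0"
  by (auto simp: lower_def monoms_def mdeg_alt)

lemma lower_empty: "lower d (Suc d) 0 = {}"
  by (auto simp: lower_def monoms_def mdeg_alt)

lemma lower_eq_shift: "c \<le> d \<Longrightarrow> lower d c 0 = (\<lambda>n. n + Poly_Mapping.single 3 c) ` monoms (d - c)"
proof (intro equalityI subsetI)
  fix n assume "c \<le> d" "n \<in> lower d c 0"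
  then show "n \<in> (\<lambda>n. n + Poly_Mapping.single 3 c) ` monoms (d - c)"
    by (intro image_eqI[of _ _ "mon (Poly_Mapping.lookup n 1) (Poly_Mapping.lookup n 2) (Poly_Mapping.lookup n 3 - c)"]
        monom3_eqI)
      (auto simp: lower_def monoms_def mdeg_alt lookup_add lookup_single)
qed (auto simp: lower_def monoms_def mdeg_alt lookup_add lookup_single)

lemma smaller_monoms:
  "{n \<in> monoms (mdeg m). n \<prec> m} = lower (mdeg m) (Poly_Mapping.lookup m 3) (Suc (Poly_Mapping.lookup m 2))"
  by (auto simp: revlex_less_def lower_def monoms_def)

text \<open>
  Counting along one row: \<open>\<rho>\<close> increases by one, going down from \<open>Suc e\<close>, exactly at the independent
  positions.  By \<open>down\<close> these form a final piece of \<open>{..e}\<close>, so their number determines them.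
\<close>

lemma staircase:
  fixes \<rho> :: "nat \<Rightarrow> nat"
  assumes step: "\<And>b. b \<le> e \<Longrightarrow> \<rho> b = (if dep b then \<rho> (Suc b) else Suc (\<rho> (Suc b)))"
    and down: "\<And>b. Suc b \<le> e \<Longrightarrow> dep (Suc b) \<Longrightarrow> dep b" and b: "b \<le> e"
  shows "dep b \<longleftrightarrow> \<not> e - b < \<rho> 0 - \<rho> (Suc e)"
proof -
  have upper: "\<rho> b \<le> \<rho> (Suc e) + (Suc e - b)" if "b \<le> Suc e" for b
    using that
  proof (induct rule: inc_induct)
    case (step b)
    then show ?case using assms(1)[of b] by (auto split: if_splits)
  qed simp
  have mono: "\<rho> b \<le> \<rho> 0" if "b \<le> Suc e" for b
    using that
  proof (induct b)
    case (Suc b)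
    then show ?case using assms(1)[of b] by (auto split: if_splits)
  qed simp
  show ?thesis
  proof (cases "dep b")
    case True
    have dep: "dep b'" if "b' \<le> b" for b'
      using that
    proof (induct rule: inc_induct)
      case (step n)
      then show ?case using down[of n] b by simp
    qed (rule True)
    have "\<rho> 0 = \<rho> b'" if "b' \<le> Suc b" for b'
      using that
    proof (induct b')
      case (Suc b')
      then show ?case using step[of b'] dep[of b'] b by simp
    qed simp
    from this[of "Suc b"] upper[of "Suc b"] b True show ?thesis by simp
  next
    case False
    have ndep: "\<not> dep b'" if "b \<le> b'" "b' \<le> e" for b'
      using that
    proof (induct rule: dec_induct)
      case (step n)
      then show ?case using down[of n] by auto
    qed (rule False)
    have "\<rho> b' = \<rho> (Suc e) + (Suc e - b')" if "b \<le> b'" "b' \<le> Suc e" for b'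
      using that(2,1)
    proof (induct rule: inc_induct)
      case (step n)
      then show ?case using assms(1)[of n] ndep[of n] by simp
    qed simp
    from this[of b] mono[of b] b False show ?thesis by simp
  qed
qed

section \<open>The expected generic initial ideal\<close>

text \<open>
  The expected dimension of the multiples of \<open>\<ell>\<^sub>3\<^sup>c\<close> in \<open>(R/I)\<^sub>d\<close>.  The default \<open>0\<close> for \<open>c > d\<close> is the true
  value, and it is needed for \<open>c = d + 1\<close>.
\<close>

definition cut_rank :: "(nat \<Rightarrow> nat) \<Rightarrow> nat \<Rightarrow> nat \<Rightarrow> nat"
  where "cut_rank H d c = (if c \<le> d then lefschetz_rank H (Max {i. H i \<noteq> 0}) (d - c) c else 0)"

text \<open>
  The difference is the number of standard monomials with the same degree and the same \<open>x\<^sub>3\<close>-exponent as \<open>m\<close>.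
\<close>

definition standard :: "(nat \<Rightarrow> nat) \<Rightarrow> monom3 \<Rightarrow> bool"
  where "standard H m \<longleftrightarrow> Poly_Mapping.lookup m 1 <
    cut_rank H (mdeg m) (Poly_Mapping.lookup m 3) - cut_rank H (mdeg m) (Suc (Poly_Mapping.lookup m 3))"

definition expected_gin :: "(nat \<Rightarrow> nat) \<Rightarrow> 'k::comm_ring_1 poly3 set"
  where "expected_gin H = ideal_gen {monomial m | m. \<not> standard H m}"

context homogeneous_quotient
begin

abbreviation sub_span :: "'k ^ 3 ^ 3 \<Rightarrow> monom3 set \<Rightarrow> 'k poly3 set"
  where "sub_span h D \<equiv> vs.span ((\<lambda>n. P (lmonom h n)) ` D)"

text \<open>
  A polynomial of \<open>gI\<close> with leading monomial \<open>m\<close> may be replaced by its component of the degree of \<open>m\<close>; pulled back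
  by \<open>g\<close>, that component is a relation modulo \<open>I\<close> between the \<open>\<ell>\<^sup>n\<close> in which only \<open>m\<close> and smaller monomials
  occur.
\<close>

lemma leading_monom_iff:
  assumes g: "invertible g"
  defines "h \<equiv> matrix_inv g"
  shows "(\<exists>f\<in>lin_subst g ` I. is_leading_monom f m) \<longleftrightarrow>
    P (lmonom h m) \<in> sub_span h {n \<in> monoms (mdeg m). n \<prec> m}"
proof
  let ?B = "{n \<in> monoms (mdeg m). n \<prec> m}"
  have hg: "h ** g = mat 1" and gh: "g ** h = mat 1"
    unfolding h_def using matrix_inv_both[OF g] by simp_all
  have fin: "finite ?B" by simp
  have mB: "m \<notin> ?B" by (simp add: revlex_less_def)
  {
    assume "\<exists>f\<in>lin_subst g ` I. is_leading_monom f m"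
    then obtain f0 where f0: "f0 \<in> I" and lead: "is_leading_monom (lin_subst g f0) m" by blast
    define f where "f = lin_subst g f0"
    define a where "a = Poly_Mapping.lookup f m"
    have a: "a \<noteq> 0" using lead unfolding is_leading_monom_def f_def[symmetric] a_def by (simp add: in_keys_iff)
    have "lin_subst h (hcomp (mdeg m) f) = hcomp (mdeg m) f0"
      unfolding f_def hcomp_lin_subst[symmetric] by (simp add: lin_subst_inverse[OF hg])
    then have 0: "P (lin_subst h (hcomp (mdeg m) f)) = 0"
      using hcomp_ideal[OF f0] kernel by simp
    have "Poly_Mapping.keys (hcomp (mdeg m) f) \<subseteq> insert m ?B"
      using lead unfolding is_leading_monom_def f_def[symmetric]
      by (auto simp: in_keys_iff monoms_def split: if_splits)
    then have "hcomp (mdeg m) f = (\<Sum>n\<in>insert m ?B. scal (Poly_Mapping.lookup (hcomp (mdeg m) f) n) (monomial n))"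
      by (intro poly_eq_sum_monomials) simp_all
    also have "\<dots> = scal a (monomial m) + (\<Sum>n\<in>?B. scal (Poly_Mapping.lookup (hcomp (mdeg m) f) n) (monomial n))"
      using fin mB by (subst sum.insert) (simp_all add: a_def)
    finally have *: "hcomp (mdeg m) f =
      scal a (monomial m) + (\<Sum>n\<in>?B. scal (Poly_Mapping.lookup (hcomp (mdeg m) f) n) (monomial n))" .
    have "scal a (P (lmonom h m)) + (\<Sum>n\<in>?B. scal (Poly_Mapping.lookup (hcomp (mdeg m) f) n) (P (lmonom h n))) = 0"
      using 0 by (subst (asm) *)
        (simp only: lin_subst_add lin_subst_sum lin_subst_scal lin_subst_monomial P.add P.sum P.scale)
    then have eq: "scal a (P (lmonom h m)) = - (\<Sum>n\<in>?B. scal (Poly_Mapping.lookup (hcomp (mdeg m) f) n) (P (lmonom h n)))"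
      by (simp only: eq_neg_iff_add_eq_0)
    have "scal a (P (lmonom h m)) \<in> sub_span h ?B"
      unfolding eq by (intro vs.span_neg span_lincomb vs.span_base) blast
    then have "scal (1 / a) (scal a (P (lmonom h m))) \<in> sub_span h ?B" by (rule vs.span_scale)
    then show "P (lmonom h m) \<in> sub_span h ?B" using a by simp
  }
  {
    assume "P (lmonom h m) \<in> sub_span h ?B"
    from span_image_lincomb[OF this fin] obtain c where c: "P (lmonom h m) = (\<Sum>n\<in>?B. scal (c n) (P (lmonom h n)))" ..
    define F where "F = monomial m - (\<Sum>n\<in>?B. scal (c n) (monomial n))"
    interpret S: Vector_Spaces.linear scal scal "lin_subst h" by (rule linear_lin_subst)
    have "P (lin_subst h F) = 0"
      unfolding F_def S.diff S.sum S.scale lin_subst_monomial P.diff P.sum P.scale c by simp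
    then have "lin_subst h F \<in> I" using kernel by blast
    moreover have "F = lin_subst g (lin_subst h F)" by (simp add: lin_subst_inverse[OF gh])
    ultimately have "F \<in> lin_subst g ` I" by (rule image_eqI[rotated])
    moreover have "is_leading_monom F m"
    proof -
      have look: "Poly_Mapping.lookup F k = (if k = m then 1 else 0) - (if k \<in> ?B then c k else 0)" for k
      proof -
        have "Poly_Mapping.lookup (\<Sum>n\<in>?B. scal (c n) (monomial n)) k = (\<Sum>n\<in>?B. if n = k then c k else 0)"
          unfolding lookup_sum by (intro sum.cong) (auto simp: monomial_def lookup_single when_def)
        also have "\<dots> = (if k \<in> ?B then c k else 0)" by (rule sum.delta[OF fin])
        finally show ?thesis
          unfolding F_def lookup_minus by (simp add: monomial_def lookup_single when_def)
      qed
      have "Poly_Mapping.lookup F m = 1" unfolding look if_not_P[OF mB] by simp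
      moreover have "n = m \<or> n \<prec> m" if "Poly_Mapping.lookup F n \<noteq> 0" for n
        using that unfolding look by (auto split: if_splits)
      ultimately show ?thesis unfolding is_leading_monom_def by (simp add: in_keys_iff)
    qed
    ultimately show "\<exists>f\<in>lin_subst g ` I. is_leading_monom f m" by blast
  }
qed

text \<open>
  Finitely many generic conditions, as only degrees up to the top degree are involved.
\<close>

definition good_coordinates :: "'k ^ 3 ^ 3 \<Rightarrow> bool"
  where "good_coordinates h \<longleftrightarrow> invertible h \<and>
    (\<forall>(d, c, b) \<in> {..top_degree I} \<times> {..top_degree I} \<times> {..top_degree I}.
      \<forall>h'. vs.dim ((\<lambda>n. P (lmonom h' n)) ` lower d c b) \<le> vs.dim ((\<lambda>n. P (lmonom h n)) ` lower d c b)) \<and>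
    (\<forall>(i, j) \<in> {..top_degree I} \<times> {..top_degree I}.
      lefschetz_rank (hilbert_fun I) (top_degree I) i j \<le> vs.dim ((\<lambda>f. P (lform h 3 ^ j * f)) ` forms i))"

lemma generic_good_coordinates:
  assumes "strong_stanley I" "finite {i. hilbert_fun I i \<noteq> 0}"
  shows "generic good_coordinates"
proof -
  obtain L where L: "L \<in> forms 1"
    "\<And>i j. lefschetz_rank (hilbert_fun I) (top_degree I) i j \<le> vs.dim ((\<lambda>f. P (L ^ j * f)) ` forms i)"
    using strong_stanley_rank[OF assms] by blast
  show ?thesis
    unfolding good_coordinates_def
    by (intro generic_conj generic_invertible generic_ball)
      (auto intro: max_rank_generic[OF finite_lower] lefschetz_generic[OF L])
qed

text \<open>
  As \<open>h\<close> is invertible, the \<open>\<ell>\<^sup>n\<close> of degree \<open>d - c\<close> span all forms of that degree, so the rank is the one of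
  multiplication by \<open>\<ell>\<^sub>3\<^sup>c\<close>.  It is at least the expected rank by genericity, and at most that rank because it
  is bounded by the dimensions of source and target.
\<close>

lemma dim_lower:
  assumes h: "good_coordinates h" and c: "c \<le> d" "d \<le> top_degree I"
  shows "vs.dim ((\<lambda>n. P (lmonom h n)) ` lower d c 0) = cut_rank (hilbert_fun I) d c"
proof -
  have inv: "invertible h" using h unfolding good_coordinates_def by blast
  define p where "p = lform h 3 ^ c"
  have p: "p \<in> forms c" unfolding p_def using forms_power[OF lform_forms, of h 3 c] by simp
  interpret M: Vector_Spaces.linear scal scal "\<lambda>f. P (p * f)" by (rule linear_mult)
  have lin: "Vector_Spaces.linear scal scal (\<lambda>f. P (p * lin_subst h f))"
    by unfold_locales (simp_all add: lin_subst_add lin_subst_scal M.add M.scale)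
  have "(\<lambda>n. P (lmonom h n)) ` lower d c 0 = (\<lambda>m. P (p * lin_subst h (monomial m))) ` monoms (d - c)"
    unfolding lower_eq_shift[OF c(1)] image_image lmonom_add_x3 lin_subst_monomial p_def ..
  then have "vs.dim ((\<lambda>n. P (lmonom h n)) ` lower d c 0) = vs.dim ((\<lambda>f. P (p * lin_subst h f)) ` forms (d - c))"
    by (simp only: dim_image_forms[OF lin])
  also have "(\<lambda>f. P (p * lin_subst h f)) ` forms (d - c) = (\<lambda>f. P (p * f)) ` forms (d - c)"
    unfolding image_image[symmetric, of "\<lambda>f. P (p * f)" "lin_subst h"] lin_subst_image_forms[OF inv] ..
  also have "vs.dim \<dots> = lefschetz_rank (hilbert_fun I) (top_degree I) (d - c) c"
  proof (rule antisym)
    show "lefschetz_rank (hilbert_fun I) (top_degree I) (d - c) c \<le> vs.dim ((\<lambda>f. P (p * f)) ` forms (d - c))"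
      using h c unfolding good_coordinates_def p_def by auto
    show "vs.dim ((\<lambda>f. P (p * f)) ` forms (d - c)) \<le> lefschetz_rank (hilbert_fun I) (top_degree I) (d - c) c"
      using dim_mult_le_target[OF p, of "d - c"] dim_mult_le_source[of p "d - c"]
      by (simp add: lefschetz_rank_def)
  qed
  finally show ?thesis using c(1) by (simp add: cut_rank_def top_degree_eq)
qed

text \<open>
  In each row of fixed degree and fixed \<open>x\<^sub>3\<close>-exponent, \<open>dependence_propagates\<close> and the two ranks of \<open>dim_lower\<close> are
  the input of the counting lemma \<open>staircase\<close>.  Above the top degree the quotient is zero, all vectors vanish, and
  no monomial is standard.
\<close>

lemma dependent_iff_not_standard:
  assumes fin: "finite {i. hilbert_fun I i \<noteq> 0}" and h: "good_coordinates h"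
  shows "P (lmonom h m) \<in> sub_span h {n \<in> monoms (mdeg m). n \<prec> m} \<longleftrightarrow> \<not> standard (hilbert_fun I) m"
proof (cases "mdeg m \<le> top_degree I")
  case False
  have zero: "hilbert_fun I (mdeg m) = 0"
  proof (rule ccontr)
    assume "hilbert_fun I (mdeg m) \<noteq> 0"
    then have "mdeg m \<le> top_degree I" unfolding top_degree_eq using fin by (intro Max_ge) auto
    then show False using False by simp
  qed
  then have "P (lmonom h m) = 0" using lmonom_forms[of h m] kernel unfolding hilbert_fun_eq_0_iff by blast
  moreover have "cut_rank (hilbert_fun I) (mdeg m) c = 0" for c
    using False zero by (auto simp: cut_rank_def lefschetz_rank_def top_degree_eq)
  ultimately show ?thesis by (simp add: standard_def vs.span_zero)
next
  case True
  define d b c where "d = mdeg m" and "b = Poly_Mapping.lookup m 2" and "c = Poly_Mapping.lookup m 3"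
  have m: "m = mon (d - c - b) b c" "Poly_Mapping.lookup m 1 = (d - c) - b" "b \<le> d - c" and c: "c \<le> d" "d \<le> top_degree I"
    using True by (auto simp: d_def b_def c_def mdeg_alt intro!: monom3_eqI)
  have smaller: "{n \<in> monoms d. n \<prec> m} = lower d c (Suc b)"
    unfolding d_def b_def c_def by (rule smaller_monoms)
  let ?v = "\<lambda>n. P (lmonom h n)"
  define \<rho> where "\<rho> b = vs.dim (?v ` lower d c b)" for b
  define dep where "dep b \<longleftrightarrow> ?v (mon (d - c - b) b c) \<in> sub_span h (lower d c (Suc b))" for b
  have "dep b \<longleftrightarrow> \<not> (d - c) - b < \<rho> 0 - \<rho> (Suc (d - c))"
  proof (rule staircase[OF _ _ m(3)])
    fix b assume b: "b \<le> d - c"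
    show "\<rho> b = (if dep b then \<rho> (Suc b) else Suc (\<rho> (Suc b)))"
      unfolding \<rho>_def dep_def lower_step[OF c(1) b] image_insert
      by (rule dim_insert_finite) simp
  next
    fix b assume b: "Suc b \<le> d - c" and dep: "dep (Suc b)"
    let ?t = "mon (d - c - Suc b) (Suc b) c" and ?D = "lower d c (Suc (Suc b))"
    have step: "insert ?t ?D = lower d c (Suc b)" using lower_step[OF c(1) b] ..
    have "shift ?t = mon (d - c - b) b c"
      using b by (intro monom3_eqI) (simp_all add: shift_def)
    moreover have "?v (shift ?t) \<in> sub_span h (insert ?t ?D)"
    proof (rule dependence_propagates)
      show "?t \<notin> ?D" by (simp add: lower_def)
      show "shift n \<in> insert ?t ?D" if "n \<in> ?D" "Poly_Mapping.lookup n 2 > 0" for n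
        unfolding step using that by (auto simp: lower_def shift_def monoms_def mdeg_alt)
      show "vs.dim ((\<lambda>n. P (lmonom h' n)) ` insert ?t ?D) \<le> vs.dim (?v ` insert ?t ?D)" for h'
        unfolding step using h b c unfolding good_coordinates_def by auto
      show "?v ?t \<in> sub_span h ?D" using dep unfolding dep_def .
    qed simp_all
    ultimately show "dep b" unfolding dep_def step by simp
  qed
  moreover have "\<rho> 0 = cut_rank (hilbert_fun I) d c"
    unfolding \<rho>_def by (rule dim_lower[OF h c])
  moreover have "\<rho> (Suc (d - c)) = cut_rank (hilbert_fun I) d (Suc c)"
  proof (cases "c = d")
    case True
    have "vs.dim ({} :: 'k poly3 set) = 0" using vs.dim_eq_card_independent[OF vs.independent_empty] by simp
    moreover have "lower d c (Suc (d - c)) = {}" using lower_last[OF c(1)] lower_empty[of d] True by (simp only:)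
    ultimately show ?thesis
      unfolding \<rho>_def using True by (simp add: cut_rank_def del: diff_self_eq_0)
  next
    case False
    then show ?thesis
      unfolding \<rho>_def lower_last[OF c(1)] using c by (intro dim_lower[OF h]) simp_all
  qed
  ultimately have "dep b \<longleftrightarrow> \<not> standard (hilbert_fun I) m"
    unfolding standard_def m(2) d_def[symmetric] c_def[symmetric] by simp
  then show ?thesis
    unfolding dep_def m(1)[symmetric] d_def[symmetric] smaller .
qed

text \<open>
  The same computation gives existence, which is Galligo's theorem in this case; uniqueness holds since any two
  nonempty open sets meet.
\<close>

lemma gin_eq_expected:
  assumes "strong_stanley I" "finite {i. hilbert_fun I i \<noteq> 0}"
  shows "gin I = expected_gin (hilbert_fun I)"
proof -
  obtain U where U: "zariski_open_GL3 U" "U \<noteq> {}" "\<And>g. g \<in> U \<Longrightarrow> invertible g"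
    "\<And>g. g \<in> U \<Longrightarrow> good_coordinates (matrix_inv g)"
    using zariski_open_of_generic[OF generic_good_coordinates[OF assms]] by blast
  have in_eq: "initial_ideal (lin_subst g ` I) = expected_gin (hilbert_fun I)" if "g \<in> U" for g
    unfolding initial_ideal_def expected_gin_def leading_monom_iff[OF U(3)[OF that]]
      dependent_iff_not_standard[OF assms(2) U(4)[OF that]] ..
  show ?thesis
    unfolding gin_def
  proof (rule the_equality)
    show "\<exists>U. zariski_open_GL3 U \<and> U \<noteq> {} \<and>
      (\<forall>g\<in>U. initial_ideal (lin_subst g ` I) = expected_gin (hilbert_fun I))"
      using U(1,2) in_eq by blast
  next
    fix M assume "\<exists>V. zariski_open_GL3 V \<and> V \<noteq> {} \<and> (\<forall>g\<in>V. initial_ideal (lin_subst g ` I) = M)"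
    then obtain V where V: "zariski_open_GL3 V" "V \<noteq> {}" "\<And>g. g \<in> V \<Longrightarrow> initial_ideal (lin_subst g ` I) = M"
      by blast
    obtain g where "g \<in> U" "g \<in> V"
      using generic_ex[OF generic_conj[OF generic_zariski_open[OF U(1,2)] generic_zariski_open[OF V(1,2)]]] by blast
    then show "M = expected_gin (hilbert_fun I)" using V(3) in_eq by metis
  qed
qed

text \<open>
  The chain \<open>I + R\<^sub>\<ge>\<^sub>n\<close> becomes stationary, and a form of degree \<open>n\<close> in \<open>I + R\<^sub>\<ge>\<^sub>n\<^sub>+\<^sub>1\<close> is in \<open>I\<close>, as one sees from
  the components of degree \<open>n\<close>.
\<close>

lemma artinian_finite_hilbert:
  assumes "artinian_ideal I"
  shows "finite {i. hilbert_fun I i \<noteq> 0}"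
proof -
  define J where "J n = ideal_gen (I \<union> (\<Union>d\<in>{n..}. forms d))" for n
  have "\<forall>n. is_ideal (J n) \<and> I \<subseteq> J n \<and> J (Suc n) \<subseteq> J n"
  proof (intro allI conjI)
    fix n
    show "is_ideal (J n)" unfolding J_def by simp
    show "I \<subseteq> J n" unfolding J_def by (rule order_trans[OF Un_upper1 idl.span_superset])
    show "J (Suc n) \<subseteq> J n" unfolding J_def by (rule idl.span_mono) (auto simp: Suc_le_eq)
  qed
  then obtain N where N: "\<And>n. n \<ge> N \<Longrightarrow> J n = J N"
    using assms unfolding artinian_ideal_def by blast
  have comp: "hcomp n f \<in> I" if "f \<in> J (Suc n)" for n f
    using that unfolding J_def
  proof (induct rule: idl.span_induct_alt)
    case base
    have "hcomp n 0 = (0 :: 'k poly3)" by (rule poly_mapping_eqI) simp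
    then show ?case using idl.subspace_0[OF ideal] by simp
  next
    case (step c x y)
    have "hcomp n (c * x) \<in> I"
    proof (cases "x \<in> I")
      case True
      then show ?thesis by (intro hcomp_ideal idl.subspace_scale[OF ideal])
    next
      case False
      then obtain e where "x \<in> forms e" "n < e" using step(1) by (auto simp: Suc_le_eq)
      then show ?thesis using idl.subspace_0[OF ideal] by (simp add: hcomp_mult_below)
    qed
    then show ?case using step(2) by (simp add: hcomp_add idl.subspace_add[OF ideal])
  qed
  have "hilbert_fun I n = 0" if "n \<ge> N" for n
    unfolding hilbert_fun_eq_0_iff
  proof
    fix f :: "'k poly3" assume f: "f \<in> forms n"
    then have "f \<in> J n" unfolding J_def by (intro idl.span_base) blast
    then have "f \<in> J (Suc n)" using N[of n] N[of "Suc n"] that by simp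
    from comp[OF this] show "f \<in> I" using hcomp_of_form[OF f, of n] by simp
  qed
  then have "{i. hilbert_fun I i \<noteq> 0} \<subseteq> {..<N}" using not_less by blast
  then show ?thesis by (rule finite_subset) simp
qed

end

section \<open>The generic initial ideal and its generators are determined\<close>

lemma homogeneous_quotient_exists:
  fixes I :: "'k::field_char_0 poly3 set"
  assumes "homogeneous_ideal I"
  shows "\<exists>P. homogeneous_quotient I P"
proof -
  obtain P :: "'k poly3 \<Rightarrow> 'k poly3" where "Vector_Spaces.linear scal scal P" "\<And>f. P f = 0 \<longleftrightarrow> f \<in> I"
    using exists_linear_with_kernel[OF ideal_subspace[OF homogeneous_ideal_hcomp(1)[OF assms]]] by blast
  then have "homogeneous_quotient I P"
    using homogeneous_ideal_hcomp[OF assms] by (intro homogeneous_quotient.intro)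
  then show ?thesis by (rule exI[of _ P])
qed

text \<open>
  The hypothesis of finiteness concerns the Hilbert function only, so it passes from \<open>I\<close> to any ideal with the same
  Hilbert function.
\<close>

theorem gin_determined:
  fixes I :: "'k::field_char_0 poly3 set"
  assumes "homogeneous_ideal I" "strong_stanley I" "finite {i. hilbert_fun I i \<noteq> 0}"
  shows "gin I = expected_gin (hilbert_fun I)"
proof -
  obtain P where "homogeneous_quotient I P" using homogeneous_quotient_exists[OF assms(1)] ..
  then show ?thesis using assms(2,3) by (rule homogeneous_quotient.gin_eq_expected)
qed

lemma artinian_finite:
  fixes I :: "'k::field_char_0 poly3 set"
  assumes "homogeneous_ideal I" "artinian_ideal I"
  shows "finite {i. hilbert_fun I i \<noteq> 0}"
proof -
  obtain P where "homogeneous_quotient I P" using homogeneous_quotient_exists[OF assms(1)] ..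
  then show ?thesis using assms(2) by (rule homogeneous_quotient.artinian_finite_hilbert)
qed

theorem proposition4p8:
  shows "(\<exists>gens :: (nat \<Rightarrow> nat) \<Rightarrow> 'k::field_char_0 poly3 set.
           \<forall>I :: 'k poly3 set.
             homogeneous_ideal I \<longrightarrow> artinian_ideal I \<longrightarrow> strong_stanley I \<longrightarrow>
             min_monomial_gens (gin I) = gens (hilbert_fun I)) \<and>
         (\<forall>I J :: 'k poly3 set.
             homogeneous_ideal I \<longrightarrow> artinian_ideal I \<longrightarrow> strong_stanley I \<longrightarrow>
             homogeneous_ideal J \<longrightarrow> (\<forall>d. hilbert_fun I d = hilbert_fun J d) \<longrightarrow>
             strong_stanley J \<longrightarrow>
             gin I = gin J)"
proof (intro conjI exI allI impI)
  fix I :: "'k poly3 set"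
  assume "homogeneous_ideal I" "artinian_ideal I" "strong_stanley I"
  then have "gin I = expected_gin (hilbert_fun I)" by (intro gin_determined artinian_finite)
  then show "min_monomial_gens (gin I) = (\<lambda>H. min_monomial_gens (expected_gin H)) (hilbert_fun I)" by simp
next
  fix I J :: "'k poly3 set"
  assume I: "homogeneous_ideal I" "artinian_ideal I" "strong_stanley I"
    and J: "homogeneous_ideal J" "strong_stanley J" and "\<forall>d. hilbert_fun I d = hilbert_fun J d"
  then have H: "hilbert_fun J = hilbert_fun I" by auto
  have fin: "finite {i. hilbert_fun I i \<noteq> 0}" by (rule artinian_finite[OF I(1,2)])
  show "gin I = gin J"
    using gin_determined[OF I(1,3) fin] gin_determined[OF J, unfolded H, OF fin] by (rule trans[OF _ sym])
qed

end
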